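(* Let $H_1,\dots,H_n$ be fixed Hermitian matrices of common dimension $d$, let $\gamma_1,\dots,\gamma_n$ be independent standard normal random variables, and let $X := \sum_{i=1}^n \gamma_i H_i$. Assume that $X$ is strongly isotropic. Define $$\sigma(X) := \left\| \sum_{i=1}^n H_i^2 \right\|^{1/2} \quad\text{and}\quad w(X) := \max_{Q_1,Q_2,Q_3} \left\| \sum_{i,j=1}^n H_i Q_1 H_j Q_2 H_i Q_3 H_j \right\|^{1/4},$$ where the maximum ranges over all triples $(Q_1,Q_2,Q_3)$ of $d \times d$ unitary matrices. Then, for each integer $p \ge 1$, $$\big( \mathbb{E} \|X\|_{2p}^{2p} \big)^{1/(2p)} \;\le\; \Big[ 2\,\sigma(X) + 2^{1/4}\, p^{5/4}\, w(X) \Big] \cdot d^{1/(2p)}.$$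
   Context: Matrices have complex entries. $\|\cdot\|$ denotes the spectral norm. The Schatten $q$-norm is $\|B\|_q := (\operatorname{tr} |B|^q)^{1/q}$ with $|B| := (B^*B)^{1/2}$. The normalized trace of a $d\times d$ matrix is $\bar{\operatorname{tr}}\, A := d^{-1} \operatorname{tr} A$. A random Hermitian matrix $X$ is called strongly isotropic when $\mathbb{E} X^p = (\mathbb{E}\, \bar{\operatorname{tr}}\, X^p) \cdot I$ for every $p = 0,1,2,\dots$, where $I$ is the identity matrix and powers bind before trace and expectation. *)

theory Defs
  imports "HOL-Probability.Probability"
begin

definition conj_transpose :: "complex^'d^'d \<Rightarrow> complex^'d^'d" where
  "conj_transpose A = map_matrix cnj (transpose A)"

definition hermitian :: "complex^'d^'d \<Rightarrow> bool" where
  "hermitian A \<longleftrightarrow> conj_transpose A = A"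

definition unitary :: "complex^'d^'d \<Rightarrow> bool" where
  "unitary Q \<longleftrightarrow> conj_transpose Q ** Q = mat 1 \<and> Q ** conj_transpose Q = mat 1"

text \<open>The operator \<open>\<bullet>\<close> on complex vectors is the real part of the Hermitian inner product; for
  Hermitian \<open>A\<close> the quadratic form is real, so nothing is lost.\<close>

definition psd :: "complex^'d^'d \<Rightarrow> bool" where
  "psd A \<longleftrightarrow> hermitian A \<and> (\<forall>v. 0 \<le> v \<bullet> (A *v v))"

text \<open>The class operations \<open>*\<close> and \<open>^\<close> on vectors and matrices act entrywise, so powers with respect
  to the matrix product need their own definition.\<close>

primrec matpow :: "complex^'d^'d \<Rightarrow> nat \<Rightarrow> complex^'d^'d" where
  "matpow A 0 = mat 1"
| "matpow A (Suc k) = A ** matpow A k"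

definition spectral_norm :: "complex^'d^'d \<Rightarrow> real" where
  "spectral_norm A = onorm ((*v) A)"

text \<open>\<open>|B| = (B\<^sup>* B)\<^bsup>1/2\<^esup>\<close>, the square root being the unique positive semidefinite one.\<close>

definition mat_abs :: "complex^'d^'d \<Rightarrow> complex^'d^'d" where
  "mat_abs B = (THE P. psd P \<and> P ** P = conj_transpose B ** B)"

text \<open>Natural exponents suffice here. The trace of \<open>|B|\<^sup>q\<close> is a nonnegative real number; \<open>Re\<close> only
  changes its type.\<close>

definition schatten_norm :: "nat \<Rightarrow> complex^'d^'d \<Rightarrow> real" where
  "schatten_norm q B = Re (trace (matpow (mat_abs B) q)) powr (1 / real q)"

definition normalized_trace :: "complex^'d^'d \<Rightarrow> complex" where
  "normalized_trace A = trace A / of_nat CARD('d)"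

text \<open>The left-hand expectation is the Bochner integral in the Euclidean space of matrices, i.e. the
  entrywise expectation. Bochner integrals of non-integrable functions are \<open>0\<close>, so the predicate is
  meaningful only for a random matrix with finite moments of all orders, such as a Gaussian one.\<close>

definition strongly_isotropic :: "'a measure \<Rightarrow> ('a \<Rightarrow> complex^'d^'d) \<Rightarrow> bool" where
  "strongly_isotropic M X \<longleftrightarrow>
     (\<forall>p. (LINT \<omega>|M. matpow (X \<omega>) p) = mat (LINT \<omega>|M. normalized_trace (matpow (X \<omega>) p)))"

definition gaussian_matrix ::
    "nat \<Rightarrow> (nat \<Rightarrow> complex^'d^'d) \<Rightarrow> (nat \<Rightarrow> 'a \<Rightarrow> real) \<Rightarrow> 'a \<Rightarrow> complex^'d^'d" where
  "gaussian_matrix n H \<gamma> \<omega> = (\<Sum>i=1..n. \<gamma> i \<omega> *\<^sub>R H i)"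

text \<open>\<open>\<sigma>(X)\<close> and \<open>w(X)\<close> are given as functions of the coefficient matrices of \<open>X\<close>.\<close>

definition sigma_par :: "nat \<Rightarrow> (nat \<Rightarrow> complex^'d^'d) \<Rightarrow> real" where
  "sigma_par n H = spectral_norm (\<Sum>i=1..n. matpow (H i) 2) powr (1/2)"

definition quartic :: "nat \<Rightarrow> (nat \<Rightarrow> complex^'d^'d) \<Rightarrow>
    complex^'d^'d \<Rightarrow> complex^'d^'d \<Rightarrow> complex^'d^'d \<Rightarrow> complex^'d^'d" where
  "quartic n H Q1 Q2 Q3 =
     (\<Sum>i=1..n. \<Sum>j=1..n. H i ** Q1 ** H j ** Q2 ** H i ** Q3 ** H j)"

text \<open>The supremum is a maximum, see \<open>w_par_attained\<close> and \<open>w_par_upper\<close> below.\<close>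

definition w_par :: "nat \<Rightarrow> (nat \<Rightarrow> complex^'d^'d) \<Rightarrow> real" where
  "w_par n H = (SUP (Q1, Q2, Q3) \<in> Collect unitary \<times> Collect unitary \<times> Collect unitary.
      spectral_norm (quartic n H Q1 Q2 Q3) powr (1/4))"

lemma continuous_on_matrix_mult:
  fixes f g :: "'b::topological_space \<Rightarrow> complex^'d^'d"
  assumes "continuous_on S f" "continuous_on S g"
  shows "continuous_on S (\<lambda>x. f x ** g x)"
  unfolding matrix_matrix_mult_def
  by (intro continuous_intros assms)

lemma continuous_on_conj_transpose: "continuous_on S (conj_transpose :: complex^'d^'d \<Rightarrow> _)"
  unfolding conj_transpose_def map_matrix_def transpose_def
  by (auto intro!: continuous_intros)

lemma norm_le_sum_norm:
  fixes x :: "'b::real_normed_vector^'d"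
  shows "norm x \<le> (\<Sum>i\<in>UNIV. norm (x $ i))"
  unfolding norm_vec_def by (rule L2_set_le_sum) simp

lemma compact_unitary: "compact (Collect unitary :: (complex^'d^'d) set)"
proof (rule compact_eq_bounded_closed[THEN iffD2], rule conjI)
  have entry: "norm (Q $ i $ j) \<le> 1" if "unitary Q" for Q :: "complex^'d^'d" and i j
  proof -
    have "complex_of_real (\<Sum>k\<in>UNIV. (cmod (Q $ i $ k))\<^sup>2) = (\<Sum>k\<in>UNIV. Q $ i $ k * cnj (Q $ i $ k))"
      unfolding of_real_sum by (intro sum.cong refl) (simp only: complex_norm_square)
    also have "\<dots> = (Q ** conj_transpose Q) $ i $ i"
      by (simp add: matrix_matrix_mult_def conj_transpose_def transpose_def)
    also have "\<dots> = complex_of_real 1" using that by (simp add: unitary_def mat_def)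
    finally have "(\<Sum>k\<in>UNIV. (cmod (Q $ i $ k))\<^sup>2) = 1" by (simp only: of_real_eq_iff)
    moreover have "(cmod (Q $ i $ j))\<^sup>2 \<le> (\<Sum>k\<in>UNIV. (cmod (Q $ i $ k))\<^sup>2)"
      by (rule member_le_sum) auto
    ultimately show ?thesis by (simp add: abs_square_le_1)
  qed
  have "norm Q \<le> (\<Sum>i\<in>(UNIV::'d set). \<Sum>j\<in>(UNIV::'d set). 1)" if "unitary Q"
    for Q :: "complex^'d^'d"
    by (rule order_trans[OF norm_le_sum_norm], rule sum_mono,
        rule order_trans[OF norm_le_sum_norm], rule sum_mono, rule entry[OF that])
  then show "bounded (Collect unitary :: (complex^'d^'d) set)"
    unfolding bounded_iff by blast
  show "closed (Collect unitary :: (complex^'d^'d) set)"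
    unfolding unitary_def
    by (intro closed_Collect_conj closed_Collect_eq continuous_on_matrix_mult
        continuous_on_conj_transpose continuous_on_id continuous_on_const)
qed

lemma spectral_norm_diff_le:
  fixes A B :: "complex^'d^'d"
  shows "spectral_norm A \<le> spectral_norm B + spectral_norm (A - B)"
proof -
  have "(*v) A = (\<lambda>x. B *v x + (A - B) *v x)"
    by (simp add: fun_eq_iff matrix_vector_mult_diff_rdistrib)
  then show ?thesis
    unfolding spectral_norm_def
    by (metis onorm_triangle matrix_vector_mul_bounded_linear)
qed

lemma spectral_norm_le_sum:
  fixes A :: "complex^'d^'d"
  shows "spectral_norm A \<le> (\<Sum>i\<in>UNIV. \<Sum>j\<in>UNIV. cmod (A $ i $ j))"
  unfolding spectral_norm_def
proof (rule onorm_le)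
  fix x :: "complex^'d"
  have "norm (A *v x) \<le> (\<Sum>i\<in>UNIV. cmod ((A *v x) $ i))"
    by (rule norm_le_sum_norm)
  also have "\<dots> \<le> (\<Sum>i\<in>UNIV. \<Sum>j\<in>UNIV. cmod (A $ i $ j) * norm x)"
    unfolding matrix_vector_mult_def vec_lambda_beta
    by (intro sum_mono sum_norm_le)
       (simp add: norm_mult mult_left_mono Finite_Cartesian_Product.norm_nth_le)
  also have "\<dots> = (\<Sum>i\<in>UNIV. \<Sum>j\<in>UNIV. cmod (A $ i $ j)) * norm x"
    by (simp add: sum_distrib_right)
  finally show "norm (A *v x) \<le> (\<Sum>i\<in>UNIV. \<Sum>j\<in>UNIV. cmod (A $ i $ j)) * norm x" .
qed

lemma continuous_on_spectral_norm:
  fixes f :: "'b::topological_space \<Rightarrow> complex^'d^'d"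
  assumes "continuous_on S f"
  shows "continuous_on S (\<lambda>x. spectral_norm (f x))"
proof -
  have "isCont spectral_norm A" for A :: "complex^'d^'d"
    unfolding isCont_def
  proof (rule LIM_zero_cancel, rule Lim_null_comparison)
    have "\<bar>spectral_norm B - spectral_norm A\<bar> \<le> (\<Sum>i\<in>UNIV. \<Sum>j\<in>UNIV. cmod (B $ i $ j - A $ i $ j))"
      for B
      using spectral_norm_diff_le[of A B] spectral_norm_diff_le[of B A]
        spectral_norm_le_sum[of "A - B"] spectral_norm_le_sum[of "B - A"]
      by (simp add: norm_minus_commute)
    then show "\<forall>\<^sub>F B in at A. norm (spectral_norm B - spectral_norm A) \<le>
        (\<Sum>i\<in>UNIV. \<Sum>j\<in>UNIV. cmod (B $ i $ j - A $ i $ j))"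
      by simp
    show "(\<lambda>B. \<Sum>i\<in>UNIV. \<Sum>j\<in>UNIV. cmod (B $ i $ j - A $ i $ j)) \<midarrow>A\<rightarrow> 0"
      by (rule tendsto_eq_intros refl)+ simp
  qed
  then show ?thesis
    using assms by (auto intro: continuous_on_compose2[where t = UNIV] continuous_at_imp_continuous_on)
qed

lemma w_par_max:
  fixes H :: "nat \<Rightarrow> complex^'d^'d"
  shows w_par_attained: "\<exists>Q1 Q2 Q3. unitary Q1 \<and> unitary Q2 \<and> unitary Q3 \<and>
      w_par n H = spectral_norm (quartic n H Q1 Q2 Q3) powr (1/4)"
    and w_par_upper: "unitary Q1 \<Longrightarrow> unitary Q2 \<Longrightarrow> unitary Q3 \<Longrightarrow>
      spectral_norm (quartic n H Q1 Q2 Q3) powr (1/4) \<le> w_par n H"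
proof -
  let ?U = "Collect unitary :: (complex^'d^'d) set"
  let ?f = "\<lambda>(Q1, Q2, Q3). spectral_norm (quartic n H Q1 Q2 Q3) powr (1/4)"
  have "compact (?U \<times> ?U \<times> ?U)" by (intro compact_Times compact_unitary)
  moreover have "?U \<times> ?U \<times> ?U \<noteq> {}"
  proof -
    have "conj_transpose (mat 1 :: complex^'d^'d) = mat 1"
      by (simp add: conj_transpose_def transpose_mat) (simp add: mat_def vec_eq_iff)
    then have "unitary (mat 1 :: complex^'d^'d)"
      by (simp add: unitary_def)
    then show ?thesis by blast
  qed
  moreover have "continuous_on (?U \<times> ?U \<times> ?U) ?f"
    unfolding case_prod_unfold quartic_def
    by (intro continuous_on_powr' continuous_on_spectral_norm continuous_on_sum
        continuous_on_matrix_mult continuous_on_const continuous_on_fst continuous_on_snd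
        continuous_on_id)
       (auto simp: spectral_norm_def intro!: onorm_pos_le)
  ultimately obtain z where z: "z \<in> ?U \<times> ?U \<times> ?U"
      "\<And>y. y \<in> ?U \<times> ?U \<times> ?U \<Longrightarrow> ?f y \<le> ?f z"
    using continuous_attains_sup[of "?U \<times> ?U \<times> ?U" ?f] by blast
  have w: "w_par n H = ?f z"
    unfolding w_par_def by (rule cSup_eq_maximum) (use z in blast)+
  obtain R1 R2 R3 where R: "z = (R1, R2, R3)" by (cases z)
  show "\<exists>Q1 Q2 Q3. unitary Q1 \<and> unitary Q2 \<and> unitary Q3 \<and>
      w_par n H = spectral_norm (quartic n H Q1 Q2 Q3) powr (1/4)"
    using w z(1) unfolding R by auto
  show "spectral_norm (quartic n H Q1 Q2 Q3) powr (1/4) \<le> w_par n H"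
    if "unitary Q1" "unitary Q2" "unitary Q3"
    using z(2)[of "(Q1, Q2, Q3)"] w that by simp
qed

end

theory Submission
  imports Defs
begin

text \<open>Let \<open>a\<^sub>k = E tr X\<^bsup>2k\<^esup> / d\<close>. Gaussian integration by parts gives
  \<open>E tr X\<^bsup>2p\<^esup> = \<Sum>\<^sub>i \<Sum>\<^sub>q E tr (H\<^sub>i X\<^bsup>q\<^esup> H\<^sub>i X\<^bsup>2p-2-q\<^esup>)\<close>. Replace the second power by the power of
  \<open>Z t = cos t X + sin t Y\<close> for an independent copy \<open>Y\<close> of \<open>X\<close>. At \<open>t = \<pi>/2\<close> the two powers are
  independent, and strong isotropy bounds the expression by \<open>d \<sigma>\<^sup>2 \<Sum>\<^sub>j a\<^sub>j a\<^bsub>p-1-j\<^esub>\<close>. Another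
  integration by parts, along the orbit of the rotation, shows that the derivative in \<open>t\<close> is \<open>-sin t\<close> times
  a sum of at most \<open>p\<^bsup>5\<^esup>/4\<close> terms
  \<open>E \<Sum>\<^sub>i\<^sub>j tr (H\<^sub>i Z\<^bsup>a\<^esup> H\<^sub>j X\<^bsup>b\<^esup> H\<^sub>i X\<^bsup>c\<^esup> H\<^sub>j Z\<^bsup>e\<^esup>)\<close> of total degree \<open>2p - 4\<close>, each at most
  \<open>4 w\<^sup>4 d a\<^bsub>p-2\<^esub>\<close>. The resulting recursion
  \<open>a\<^sub>p \<le> \<sigma>\<^sup>2 \<Sum>\<^sub>j a\<^sub>j a\<^bsub>p-1-j\<^esub> + p\<^bsup>5\<^esup> w\<^sup>4 a\<^bsub>p-2\<^esub>\<close> is solved by a generating function majorant.\<close>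

section \<open>Spectral theorem and even Schatten norms\<close>

text \<open>The obstacle is that \<open>w\<close> controls only unitary arguments, whereas the
  interpolation produces unbounded powers of \<open>X\<close> and \<open>Z t\<close>. A Hermitian
  contraction is the average of two unitaries, so three slots may hold contractions while the fourth
  is measured in trace norm. Powers of mixed degrees are reached by lowering the eigenvalue levels
  one at a time, at the cost of adding four power sums; that is the 4 in \<open>4 w^4\<close>, since
  \<open>Z t\<close> has the same trace moments as \<open>X\<close>. The derivative contains only
  alternating words \<open>H_j .. H_k .. H_j .. H_k\<close>: the integration by parts runs in
  directions along which \<open>Z t\<close> does not move, so the new pair of coefficients always
  separates the old one. Isotropy enters only at the quarter turn, where it makes averaged powers
  scalar. The integral of \<open>sin\<close> over the quarter turn is 1, so no constant is lost
  there. Without the \<open>w\<close> term the recursion is the Catalan one, with growth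
  \<open>(2 \<sigma>)^(2p)\<close>; the correction enters through \<open>l\<close> with
  \<open>l^4 = 2 p^5 w^4\<close>, the origin of \<open>2^(1/4) p^(5/4)\<close>.\<close>

lemma conj_transpose_nth [simp]: "conj_transpose A $ i $ j = cnj (A $ j $ i)"
  by (simp add: conj_transpose_def transpose_def)

lemma matrix_mult_nth: "(A ** B) $ i $ j = (\<Sum>k\<in>UNIV. A $ i $ k * B $ k $ j)"
  by (simp add: matrix_matrix_mult_def)

lemma conj_transpose_mult: "conj_transpose (A ** B) = conj_transpose B ** conj_transpose A"
  by (simp add: vec_eq_iff matrix_mult_nth mult.commute)

lemma conj_transpose_conj_transpose [simp]: "conj_transpose (conj_transpose A) = A"
  by (simp add: vec_eq_iff)

lemma unitary_conj_transpose: "unitary U \<Longrightarrow> unitary (conj_transpose U)"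
  by (simp add: unitary_def)

lemma inner_matrix_vector_mult:
  fixes A :: "complex^'d^'d"
  shows "(A *v x) \<bullet> y = x \<bullet> (conj_transpose A *v y)"
proof -
  have "(A *v x) \<bullet> y = (\<Sum>i\<in>UNIV. \<Sum>j\<in>UNIV. Re (A $ i $ j * x $ j * cnj (y $ i)))"
    by (simp add: inner_vec_def matrix_vector_mult_def inner_complex_def sum_distrib_right sum.distrib
        flip: Re_sum)
       (simp add: algebra_simps sum_subtractf sum.distrib sum_distrib_left sum_distrib_right sum_negf)
  also have "\<dots> = (\<Sum>j\<in>UNIV. \<Sum>i\<in>UNIV. Re (A $ i $ j * x $ j * cnj (y $ i)))"
    by (rule sum.swap)
  also have "\<dots> = x \<bullet> (conj_transpose A *v y)"
    by (simp add: inner_vec_def matrix_vector_mult_def inner_complex_def sum_distrib_left sum.distrib)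
       (simp add: algebra_simps sum_subtractf sum.distrib sum_distrib_left sum_distrib_right sum_negf)
  finally show ?thesis .
qed

lemma norm_unitary_vector_mult:
  fixes U :: "complex^'d^'d"
  assumes "unitary U"
  shows "norm (U *v x) = norm x"
  using assms
  by (simp add: norm_eq_sqrt_inner inner_matrix_vector_mult matrix_vector_mul_assoc unitary_def)

text \<open>The operator \<open>\<bullet>\<close> keeps only the real part, but eigenvectors must be
  orthonormal over the complex numbers. The missing imaginary part is the real inner product with
  \<open>\<i> *s u\<close>.\<close>

definition hinner :: "complex^'d \<Rightarrow> complex^'d \<Rightarrow> complex" where
  "hinner u v = (\<Sum>i\<in>UNIV. cnj (u $ i) * v $ i)"

lemma Re_hinner: "Re (hinner u v) = u \<bullet> v"
  by (simp add: hinner_def inner_vec_def inner_complex_def)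

lemma Im_hinner: "Im (hinner u v) = (\<i> *s u) \<bullet> v"
  by (simp add: hinner_def inner_vec_def inner_complex_def)

lemma hinner_eq_0_iff: "hinner u v = 0 \<longleftrightarrow> u \<bullet> v = 0 \<and> (\<i> *s u) \<bullet> v = 0"
  by (simp add: complex_eq_iff Re_hinner Im_hinner)

lemma hinner_commute: "hinner v u = cnj (hinner u v)"
  by (simp add: hinner_def mult.commute)

lemma hinner_self: "hinner u u = of_real ((norm u)\<^sup>2)"
  by (simp add: complex_eq_iff Re_hinner Im_hinner power2_norm_eq_inner)
     (simp add: inner_vec_def inner_complex_def)

lemma matrix_vector_mult_scaleC: "A *v (c *s x) = c *s (A *v x)" for A :: "complex^'d^'d"
  by (simp add: vec_eq_iff matrix_vector_mult_def sum_distrib_left mult_ac)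

lemma matrix_vector_mult_scaleR_complex: "A *v (c *\<^sub>R x) = c *\<^sub>R (A *v x)" for A :: "complex^'d^'d"
  by (simp add: vec_eq_iff matrix_vector_mult_def scaleR_sum_right)

text \<open>First variation at a maximum: for small positive \<open>t\<close> the linear term beats
  the quadratic one unless its coefficient \<open>a\<close> vanishes.\<close>

lemma quadratic_le_imp_zero:
  fixes a b :: real
  assumes "0 \<le> a" and "\<And>t. 2 * t * a \<le> t\<^sup>2 * b"
  shows "a = 0"
proof (rule ccontr)
  assume "a \<noteq> 0"
  with assms(1) have a: "a > 0" by simp
  define t where "t = a / (\<bar>b\<bar> + 1)"
  have t: "t > 0" using a by (simp add: t_def)
  have "t * b \<le> t * (\<bar>b\<bar> + 1)" using t by (intro mult_left_mono) auto
  also have "\<dots> = a" by (simp add: t_def)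
  finally have "t * (t * b) \<le> t * a" using t by simp
  then have "2 * (t * a) \<le> t * a" using assms(2)[of t] by (simp add: power2_eq_square mult_ac)
  moreover have "0 < t * a" using t a by simp
  ultimately show False by linarith
qed

text \<open>A maximizer of the Rayleigh quotient over the orthogonal complement of the eigenvectors
  found so far.\<close>

lemma hermitian_new_eigenvector:
  fixes A :: "complex^'d^'d"
  assumes A: "hermitian A" and S: "finite S" "card S < CARD('d)"
    and eig: "\<And>s. s \<in> S \<Longrightarrow> \<exists>l::real. A *v s = l *\<^sub>R s"
  obtains v and l :: real where "norm v = 1" "\<And>s. s \<in> S \<Longrightarrow> hinner s v = 0" "A *v v = l *\<^sub>R v"
proof -
  \<comment> \<open>The complex orthogonal complement of \<open>S\<close>, written with real inner
    products so that Euclidean topology and dimension theory apply.\<close>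
  define V where "V = {v. \<forall>s\<in>S. s \<bullet> v = 0 \<and> (\<i> *s s) \<bullet> v = 0}"
  have adj: "x \<bullet> (A *v y) = (A *v x) \<bullet> y" for x y
    using A by (simp add: inner_matrix_vector_mult hermitian_def)
  have V_A: "A *v v \<in> V" if "v \<in> V" for v
  proof -
    have "s \<bullet> (A *v v) = 0 \<and> (\<i> *s s) \<bullet> (A *v v) = 0" if s: "s \<in> S" for s
    proof -
      obtain l :: real where l: "A *v s = l *\<^sub>R s" using eig[OF s] by blast
      have "A *v (\<i> *s s) = l *\<^sub>R (\<i> *s s)"
        unfolding matrix_vector_mult_scaleC l by (simp add: vec_eq_iff)
      then show ?thesis using l \<open>v \<in> V\<close> s by (simp add: adj V_def)
    qed
    then show ?thesis by (simp add: V_def)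
  qed
  have V_lin: "a *\<^sub>R v + b *\<^sub>R w \<in> V" if "v \<in> V" "w \<in> V" for a b v w
    using that by (simp add: V_def inner_add_right)
  have closed: "closed V"
  proof -
    have "V = (\<Inter>s\<in>S. {v. s \<bullet> v = 0} \<inter> {v. (\<i> *s s) \<bullet> v = 0})" by (auto simp: V_def)
    then show ?thesis by (simp add: closed_INT closed_Int closed_hyperplane)
  qed
  \<comment> \<open>Over the reals there are at most \<open>2 * card S\<close> orthogonality
    conditions, against the real dimension \<open>2 * CARD('d)\<close>.\<close>
  let ?T = "S \<union> (*s) \<i> ` S"
  have "card ?T \<le> card S + card S"
    by (rule order_trans[OF card_Un_le]) (simp add: card_image_le S)
  then have "card ?T < DIM(complex^'d)" using S by simp
  moreover have "dim ?T \<le> card ?T" using S by (intro dim_le_card) (auto simp: span_base)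
  ultimately have "dim ?T < DIM(complex^'d)" by simp
  then obtain x where x: "x \<noteq> 0" "\<And>y. y \<in> span ?T \<Longrightarrow> orthogonal x y"
    using orthogonal_to_subspace_exists by blast
  have "s \<bullet> x = 0" if "s \<in> ?T" for s
    using x(2)[OF span_base[OF that]] by (simp add: orthogonal_def inner_commute)
  then have "x \<in> V" by (simp add: V_def)
  then have "(1 / norm x) *\<^sub>R x \<in> sphere 0 1 \<inter> V"
    using V_lin[of x x "1 / norm x" 0] x(1) by simp
  then have "sphere 0 1 \<inter> V \<noteq> {}" by blast
  moreover have "compact (sphere 0 1 \<inter> V)"
    using closed by (simp add: compact_Int_closed)
  moreover have "continuous_on (sphere 0 1 \<inter> V) (\<lambda>v. v \<bullet> (A *v v))"
    by (intro continuous_intros linear_continuous_on matrix_vector_mul_bounded_linear)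
  ultimately obtain v where v: "v \<in> sphere 0 1 \<inter> V"
    and max: "\<And>w. w \<in> sphere 0 1 \<inter> V \<Longrightarrow> w \<bullet> (A *v w) \<le> v \<bullet> (A *v v)"
    using continuous_attains_sup[of "sphere 0 1 \<inter> V" "\<lambda>v. v \<bullet> (A *v v)"] by blast
  define l where "l = v \<bullet> (A *v v)"
  have quad: "w \<bullet> (A *v w) \<le> l * (w \<bullet> w)" if "w \<in> V" for w
  proof (cases "w = 0")
    case False
    have "(1 / norm w) *\<^sub>R w \<in> sphere 0 1 \<inter> V"
      using V_lin[of w w "1 / norm w" 0] that False by simp
    from max[OF this] have "(w \<bullet> (A *v w)) / (norm w)\<^sup>2 \<le> l"
      by (simp add: l_def matrix_vector_mult_scaleR_complex power2_eq_square)
    with False show ?thesis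
      unfolding power2_norm_eq_inner[symmetric] by (simp add: pos_divide_le_eq)
  qed simp
  \<comment> \<open>The residual of the eigenvalue equation. It lies in \<open>V\<close>, and unless
    it vanishes, moving from \<open>v\<close> in its direction would increase the Rayleigh quotient
    to first order.\<close>
  define g where "g = A *v v - l *\<^sub>R v"
  have gV: "g \<in> V" using V_lin[OF V_A, of v v 1 "-l"] v by (simp add: g_def)
  have vv: "v \<bullet> v = 1" using v by (simp add: norm_eq_1)
  have "g \<bullet> g = 0"
  proof (rule quadratic_le_imp_zero)
    fix t :: real
    have "v + t *\<^sub>R g \<in> V" using V_lin[of v g 1 t] v gV by simp
    from quad[OF this]
    have "(v + t *\<^sub>R g) \<bullet> (A *v v + t *\<^sub>R (A *v g)) \<le> l * ((v + t *\<^sub>R g) \<bullet> (v + t *\<^sub>R g))"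
      by (simp add: matrix_vector_right_distrib matrix_vector_mult_scaleR_complex)
    moreover have "v \<bullet> (A *v g) = g \<bullet> (A *v v)" by (subst adj) (rule inner_commute)
    moreover have "g \<bullet> (A *v v) = g \<bullet> g + l * (v \<bullet> g)"
      by (simp add: g_def inner_diff_left inner_diff_right inner_commute algebra_simps)
    ultimately show "2 * t * (g \<bullet> g) \<le> t\<^sup>2 * (l * (g \<bullet> g) - g \<bullet> (A *v g))"
      by (simp add: inner_add_left inner_add_right vv inner_commute[of g v] flip: l_def)
         (simp add: algebra_simps power2_eq_square)
  qed simp
  then have "A *v v = l *\<^sub>R v" by (simp add: g_def)
  moreover have "hinner s v = 0" if "s \<in> S" for s
    using v that by (simp add: hinner_eq_0_iff V_def)
  ultimately show thesis using that v by auto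
qed

section \<open>Functional calculus and the matrix absolute value\<close>

definition diag_mat :: "('d \<Rightarrow> complex) \<Rightarrow> complex^'d^'d" where
  "diag_mat f = (\<chi> i j. if i = j then f i else 0)"

text \<open>The eigenvalues form a real function on the index type. For a fixed \<open>U\<close>,
  products, powers and absolute values become pointwise operations on \<open>f\<close>.\<close>

definition spectral_mat :: "complex^'d^'d \<Rightarrow> ('d \<Rightarrow> real) \<Rightarrow> complex^'d^'d" where
  "spectral_mat U f = U ** diag_mat (\<lambda>i. of_real (f i)) ** conj_transpose U"

text \<open>Induction over the index set: a new orthogonal eigenvector exists as long as fewer than
  \<open>CARD('d)\<close> have been found, which holds on every proper subset of the index
  type.\<close>

lemma hermitian_eigenbasis:
  fixes A :: "complex^'d^'d"
  assumes A: "hermitian A"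
  shows "\<exists>(e :: 'd \<Rightarrow> complex^'d) (l :: 'd \<Rightarrow> real).
    (\<forall>i j. hinner (e i) (e j) = (if i = j then 1 else 0)) \<and> (\<forall>i. A *v e i = l i *\<^sub>R e i)"
proof -
  have "\<exists>(e :: 'd \<Rightarrow> complex^'d) (l :: 'd \<Rightarrow> real).
      (\<forall>i\<in>K. \<forall>j\<in>K. hinner (e i) (e j) = (if i = j then 1 else 0)) \<and> (\<forall>i\<in>K. A *v e i = l i *\<^sub>R e i)"
    if "finite K" for K :: "'d set"
    using that
  proof (induction K)
    case empty
    then show ?case by simp
  next
    case (insert k K)
    then obtain e :: "'d \<Rightarrow> complex^'d" and l :: "'d \<Rightarrow> real"
      where o: "\<forall>i\<in>K. \<forall>j\<in>K. hinner (e i) (e j) = (if i = j then 1 else 0)"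
        and eig: "\<forall>i\<in>K. A *v e i = l i *\<^sub>R e i" by blast
    have "card (e ` K) \<le> card K" using insert by (simp add: card_image_le)
    also have "card K < CARD('d)"
      using insert by (intro psubset_card_mono) auto
    finally obtain v and m :: real where v: "norm v = 1" "\<And>s. s \<in> e ` K \<Longrightarrow> hinner s v = 0" "A *v v = m *\<^sub>R v"
      using hermitian_new_eigenvector[OF A, of "e ` K"] eig insert by blast
    have "hinner v (e i) = 0" if "i \<in> K" for i
      using v(2)[of "e i"] that by (subst hinner_commute) simp
    moreover have "hinner v v = 1" using v(1) by (simp add: hinner_self)
    ultimately show ?case
      using o eig v insert.hyps
      by (intro exI[of _ "e(k := v)"] exI[of _ "l(k := m)"]) auto
  qed
  from this[of UNIV] show ?thesis by simp
qed

lemma matrix_mult_diag_mat: "(A ** diag_mat f) $ i $ j = A $ i $ j * f j"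
  by (simp add: matrix_mult_nth diag_mat_def if_distrib cong: if_cong)

lemma diag_mat_mult: "diag_mat f ** diag_mat g = diag_mat (\<lambda>i. f i * g i)"
  by (simp add: vec_eq_iff matrix_mult_diag_mat) (simp add: diag_mat_def)

theorem spectral_theorem:
  fixes A :: "complex^'d^'d"
  assumes "hermitian A"
  obtains U l where "unitary U" "A = spectral_mat U l"
proof -
  obtain e :: "'d \<Rightarrow> complex^'d" and l :: "'d \<Rightarrow> real"
    where e: "\<And>i j. hinner (e i) (e j) = (if i = j then 1 else 0)"
      and l: "\<And>i. A *v e i = l i *\<^sub>R e i"
    using hermitian_eigenbasis[OF assms] by auto
  define U :: "complex^'d^'d" where "U = (\<chi> i j. e j $ i)"
  have "conj_transpose U ** U = mat 1"
    using e by (simp add: vec_eq_iff matrix_mult_nth U_def mat_def hinner_def)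
  then have U: "unitary U" unfolding unitary_def using matrix_left_right_inverse by blast
  have "(A ** U) $ i $ j = (A *v e j) $ i" for i j
    by (simp add: matrix_mult_nth matrix_vector_mult_def U_def)
  then have "A ** U = U ** diag_mat (\<lambda>i. of_real (l i))"
    by (simp add: vec_eq_iff matrix_mult_diag_mat l) (simp add: U_def scaleR_conv_of_real)
  then have "A ** (U ** conj_transpose U) = spectral_mat U l"
    by (simp add: spectral_mat_def matrix_mul_assoc)
  then have "A = spectral_mat U l" using U by (simp add: unitary_def)
  with U that show thesis by blast
qed

lemma spectral_mat_mult:
  assumes "unitary U"
  shows "spectral_mat U f ** spectral_mat U g = spectral_mat U (\<lambda>i. f i * g i)"
proof -
  have "spectral_mat U f ** spectral_mat U g = U ** diag_mat (\<lambda>i. of_real (f i)) **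
      (conj_transpose U ** U) ** diag_mat (\<lambda>i. of_real (g i)) ** conj_transpose U"
    by (simp only: spectral_mat_def matrix_mul_assoc)
  also have "\<dots> = U ** (diag_mat (\<lambda>i. of_real (f i)) ** diag_mat (\<lambda>i. of_real (g i))) ** conj_transpose U"
    using assms by (simp add: unitary_def matrix_mul_assoc)
  finally show ?thesis by (simp add: diag_mat_mult spectral_mat_def)
qed

lemma spectral_mat_1: "unitary U \<Longrightarrow> spectral_mat U (\<lambda>i. 1) = mat 1"
proof -
  have "diag_mat (\<lambda>i. 1) = (mat 1 :: complex^'a^'a)" by (simp add: diag_mat_def mat_def)
  then show "unitary U \<Longrightarrow> ?thesis" by (simp add: spectral_mat_def unitary_def)
qed

lemma matpow_spectral_mat: "unitary U \<Longrightarrow> matpow (spectral_mat U f) k = spectral_mat U (\<lambda>i. f i ^ k)"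
  by (induction k) (simp_all add: spectral_mat_1 spectral_mat_mult)

lemma trace_spectral_mat: "unitary U \<Longrightarrow> trace (spectral_mat U f) = of_real (\<Sum>i\<in>UNIV. f i)"
proof -
  assume U: "unitary U"
  have "trace (spectral_mat U f) = trace (conj_transpose U ** (U ** diag_mat (\<lambda>i. of_real (f i))))"
    unfolding spectral_mat_def by (rule trace_mul_sym)
  also have "\<dots> = trace (diag_mat (\<lambda>i. of_real (f i)) :: complex^_^_)"
    using U by (simp add: matrix_mul_assoc unitary_def)
  finally show ?thesis by (simp add: trace_def diag_mat_def)
qed

lemma conj_transpose_diag_mat: "conj_transpose (diag_mat f) = diag_mat (\<lambda>i. cnj (f i))"
  by (simp add: vec_eq_iff diag_mat_def)

lemma conj_transpose_spectral_mat: "conj_transpose (spectral_mat U f) = spectral_mat U f"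
  by (simp add: spectral_mat_def conj_transpose_mult matrix_mul_assoc conj_transpose_diag_mat)

lemma psd_spectral_mat:
  assumes "unitary U" "\<And>i. 0 \<le> f i"
  shows "psd (spectral_mat U f)"
  unfolding psd_def hermitian_def
proof (intro conjI allI conj_transpose_spectral_mat)
  fix v
  have "spectral_mat U (\<lambda>i. sqrt (f i)) ** spectral_mat U (\<lambda>i. sqrt (f i)) = spectral_mat U f"
    using assms by (simp add: spectral_mat_mult)
  then have "v \<bullet> (spectral_mat U f *v v) =
      v \<bullet> (spectral_mat U (\<lambda>i. sqrt (f i)) *v (spectral_mat U (\<lambda>i. sqrt (f i)) *v v))"
    by (simp add: matrix_vector_mul_assoc)
  also have "\<dots> = (spectral_mat U (\<lambda>i. sqrt (f i)) *v v) \<bullet> (spectral_mat U (\<lambda>i. sqrt (f i)) *v v)"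
    by (simp add: inner_matrix_vector_mult conj_transpose_spectral_mat)
  finally show "0 \<le> v \<bullet> (spectral_mat U f *v v)" by simp
qed

text \<open>For an eigenvector \<open>e\<close> of \<open>P ** P\<close> the operator
  \<open>P + f\<close> annihilates \<open>(P - f) e\<close>. A nonzero such vector would be an
  eigenvector of \<open>P\<close> for \<open>-f\<close>, which positivity excludes when
  \<open>f > 0\<close>. This determines the \<open>THE\<close> in \<open>mat_abs\<close>.\<close>

lemma psd_square_root_unique:
  assumes U: "unitary U" and f: "\<And>i. 0 \<le> f i"
    and P: "psd P" "P ** P = spectral_mat U (\<lambda>i. (f i)\<^sup>2)"
  shows "P = spectral_mat U f"
proof -
  have spec: "spectral_mat U g *v column i U = g i *\<^sub>R column i U" for g i
  proof -
    have "spectral_mat U g ** U = U ** diag_mat (\<lambda>i. of_real (g i))"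
      using U by (simp add: spectral_mat_def unitary_def flip: matrix_mul_assoc)
    then have "(spectral_mat U g ** U) $ k $ i = U $ k $ i * of_real (g i)" for k
      by (simp add: matrix_mult_diag_mat)
    then show ?thesis
      by (simp add: vec_eq_iff matrix_mult_nth matrix_vector_mult_def column_def) (simp add: scaleR_conv_of_real mult.commute)
  qed
  have "P *v column i U = f i *\<^sub>R column i U" for i
  proof -
    define e where "e = column i U"
    define g where "g = P *v e - f i *\<^sub>R e"
    have PP: "P *v (P *v e) = (f i)\<^sup>2 *\<^sub>R e"
      by (simp add: matrix_vector_mul_assoc P(2) spec e_def)
    have adj: "x \<bullet> (P *v y) = (P *v x) \<bullet> y" for x y
      using P(1) by (simp add: inner_matrix_vector_mult hermitian_def psd_def)
    have "P *v g = - f i *\<^sub>R g"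
      by (simp add: g_def matrix_vector_mult_diff_distrib matrix_vector_mult_scaleR_complex PP
          scaleR_diff_right power2_eq_square)
    moreover have "0 \<le> g \<bullet> (P *v g)" using P(1) by (simp add: psd_def)
    ultimately have *: "f i * (g \<bullet> g) \<le> 0" by simp
    have "g = 0"
    proof (cases "f i = 0")
      \<comment> \<open>Positivity says nothing here. Instead, \<open>P ** P\<close> annihilates
        \<open>e\<close>, and so does \<open>P\<close> because it is Hermitian.\<close>
      case True
      have "(P *v e) \<bullet> (P *v e) = e \<bullet> (P *v (P *v e))" by (simp only: adj)
      then show ?thesis using PP True by (simp add: g_def)
    next
      case False
      then have "g \<bullet> g \<le> 0" using * f[of i] by (simp add: mult_le_0_iff)
      then show ?thesis by (metis inner_eq_zero_iff inner_ge_zero order_antisym)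
    qed
    then show ?thesis by (simp add: g_def e_def)
  qed
  then have "column i (P ** U) = column i (spectral_mat U f ** U)" for i
    using spec[of f i] by (simp add: vec_eq_iff column_def matrix_mult_nth matrix_vector_mult_def)
  then have "P ** U = spectral_mat U f ** U" by (simp add: vec_eq_iff column_def)
  then have "P ** (U ** conj_transpose U) = spectral_mat U f ** (U ** conj_transpose U)"
    by (simp add: matrix_mul_assoc)
  then show ?thesis using U by (simp add: unitary_def)
qed

lemma mat_abs_spectral_mat:
  assumes U: "unitary U"
  shows "mat_abs (spectral_mat U f) = spectral_mat U (\<lambda>i. \<bar>f i\<bar>)"
  unfolding mat_abs_def
proof (rule the_equality)
  have *: "conj_transpose (spectral_mat U f) ** spectral_mat U f = spectral_mat U (\<lambda>i. \<bar>f i\<bar>\<^sup>2)"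
    using U by (simp add: conj_transpose_spectral_mat spectral_mat_mult power2_eq_square)
  then show "psd (spectral_mat U (\<lambda>i. \<bar>f i\<bar>)) \<and>
      spectral_mat U (\<lambda>i. \<bar>f i\<bar>) ** spectral_mat U (\<lambda>i. \<bar>f i\<bar>) =
      conj_transpose (spectral_mat U f) ** spectral_mat U f"
    using U by (simp add: psd_spectral_mat spectral_mat_mult power2_eq_square)
  show "P = spectral_mat U (\<lambda>i. \<bar>f i\<bar>)"
    if "psd P \<and> P ** P = conj_transpose (spectral_mat U f) ** spectral_mat U f" for P
    using psd_square_root_unique[OF U, of "\<lambda>i. \<bar>f i\<bar>" P] that * by simp
qed

text \<open>An even power does not see the sign of an eigenvalue, so the absolute value disappears
  and a trace of a polynomial in \<open>B\<close> remains, which is accessible to integration by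
  parts.\<close>

lemma schatten_norm_even_power:
  fixes B :: "complex^'d^'d"
  assumes "hermitian B" "p \<ge> 1"
  shows "schatten_norm (2 * p) B ^ (2 * p) = Re (trace (matpow B (2 * p)))"
proof -
  obtain U f where U: "unitary U" and B: "B = spectral_mat U f"
    using spectral_theorem[OF assms(1)] by metis
  have tr: "trace (matpow (mat_abs B) (2 * p)) = trace (matpow B (2 * p))"
    unfolding B mat_abs_spectral_mat[OF U] matpow_spectral_mat[OF U] power_mult power2_abs by (rule refl)
  have "Re (trace (matpow B (2 * p))) = (\<Sum>i\<in>UNIV. f i ^ (2 * p))"
    unfolding B matpow_spectral_mat[OF U] trace_spectral_mat[OF U] by simp
  then have "0 \<le> Re (trace (matpow B (2 * p)))" by (simp add: sum_nonneg)
  then show ?thesis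
    using assms(2) unfolding schatten_norm_def tr
    by (cases "Re (trace (matpow B (2 * p))) = 0") (simp_all add: powr_powr flip: powr_realpow)
qed

section \<open>Bounds for the quartic trace form\<close>

lemma spectral_norm_nonneg: "0 \<le> spectral_norm A"
  for A :: "complex^'d^'d"
  unfolding spectral_norm_def by (rule onorm_pos_le[OF matrix_vector_mul_bounded_linear])

lemma norm_matrix_vector_mult_le: "norm (A *v x) \<le> spectral_norm A * norm x"
  for A :: "complex^'d^'d"
  unfolding spectral_norm_def by (rule onorm[OF matrix_vector_mul_bounded_linear])

lemma norm_entry_le_spectral_norm:
  fixes A :: "complex^'d^'d"
  shows "norm (A $ i $ j) \<le> spectral_norm A"
proof -
  have "norm (A $ i $ j) = norm ((A *v axis j 1) $ i)"
    by (simp add: matrix_vector_mult_def axis_def if_distrib cong: if_cong)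
  also have "\<dots> \<le> norm (A *v axis j 1)" by (rule Finite_Cartesian_Product.norm_nth_le)
  also have "\<dots> \<le> spectral_norm A"
    using norm_matrix_vector_mult_le[of A "axis j 1"] by (simp add: norm_axis_1)
  finally show ?thesis .
qed

lemma norm_trace_le: "norm (trace A) \<le> real CARD('d) * spectral_norm A"
  for A :: "complex^'d^'d"
  unfolding trace_def by (rule sum_norm_bound) (rule norm_entry_le_spectral_norm)

lemma spectral_norm_unitary_conj_le:
  fixes A :: "complex^'d^'d"
  assumes "unitary U"
  shows "spectral_norm (conj_transpose U ** A ** U) \<le> spectral_norm A"
  unfolding spectral_norm_def[of "conj_transpose U ** A ** U"]
proof (rule onorm_le)
  fix x
  have "norm ((conj_transpose U ** A ** U) *v x) = norm (A *v (U *v x))"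
    using norm_unitary_vector_mult[OF unitary_conj_transpose[OF assms]]
    by (simp flip: matrix_vector_mul_assoc)
  also have "\<dots> \<le> spectral_norm A * norm (U *v x)" by (rule norm_matrix_vector_mult_le)
  finally show "norm ((conj_transpose U ** A ** U) *v x) \<le> spectral_norm A * norm x"
    using assms by (simp add: norm_unitary_vector_mult)
qed

text \<open>Duality of spectral and trace norm, evaluated in the eigenbasis of the second
  factor.\<close>

lemma norm_trace_mult_spectral_mat_le:
  fixes A :: "complex^'d^'d"
  assumes U: "unitary U"
  shows "norm (trace (A ** spectral_mat U f)) \<le> spectral_norm A * (\<Sum>k\<in>UNIV. \<bar>f k\<bar>)"
proof -
  let ?B = "conj_transpose U ** A ** U"
  have "trace (A ** spectral_mat U f) = trace ((A ** U ** diag_mat (\<lambda>i. of_real (f i))) ** conj_transpose U)"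
    by (simp add: spectral_mat_def matrix_mul_assoc)
  also have "\<dots> = trace (?B ** diag_mat (\<lambda>i. of_real (f i)))"
    by (subst trace_mul_sym) (simp add: matrix_mul_assoc)
  also have "\<dots> = (\<Sum>k\<in>UNIV. ?B $ k $ k * of_real (f k))"
    by (simp add: trace_def matrix_mult_diag_mat)
  also have "norm \<dots> \<le> (\<Sum>k\<in>UNIV. spectral_norm A * \<bar>f k\<bar>)"
    using norm_entry_le_spectral_norm[of ?B] spectral_norm_unitary_conj_le[OF U, of A]
    by (intro sum_norm_le) (auto simp: norm_mult intro!: mult_right_mono intro: order_trans)
  finally show ?thesis by (simp add: sum_distrib_left)
qed

lemma matrix_mult_add_left: "(A + B) ** C = A ** C + B ** C"
  for C :: "complex^'d^'d"
  by (simp add: vec_eq_iff matrix_mult_nth algebra_simps sum.distrib)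

lemma matrix_mult_sum_left: "(\<Sum>i\<in>I. A i) ** B = (\<Sum>i\<in>I. A i ** B)"
  for B :: "complex^'d^'d"
  by (simp add: vec_eq_iff matrix_mult_nth sum_distrib_right) (intro allI sum.swap)

lemma matrix_mult_sum_right: "B ** (\<Sum>i\<in>I. A i) = (\<Sum>i\<in>I. B ** A i)"
  for B :: "complex^'d^'d"
  by (simp add: vec_eq_iff matrix_mult_nth sum_distrib_left) (intro allI sum.swap)

lemma trace_sum: "trace (\<Sum>i\<in>I. A i) = (\<Sum>i\<in>I. trace (A i))"
  unfolding trace_def by (simp add: sum.swap[of _ I])

lemma matrix_mult_scaleR_left: "(c *\<^sub>R A) ** B = c *\<^sub>R (A ** B)"
  for A B :: "complex^'d^'d"
  by (simp add: vec_eq_iff matrix_mult_nth scaleR_sum_right)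

lemma matrix_mult_scaleR_right: "A ** (c *\<^sub>R B) = c *\<^sub>R (A ** B)"
  for A B :: "complex^'d^'d"
  by (simp add: vec_eq_iff matrix_mult_nth scaleR_sum_right)

lemma trace_scaleR: "trace (c *\<^sub>R A) = of_real c * trace A"
  for A :: "complex^'d^'d"
  by (simp add: trace_def sum_distrib_left) (simp add: scaleR_conv_of_real)

section \<open>The quartic trace as a cyclic multilinear form\<close>

definition quartic_trace :: "nat \<Rightarrow> (nat \<Rightarrow> complex^'d^'d) \<Rightarrow>
    complex^'d^'d \<Rightarrow> complex^'d^'d \<Rightarrow> complex^'d^'d \<Rightarrow> complex^'d^'d \<Rightarrow> complex" where
  "quartic_trace n H A B C D = trace (quartic n H A B C ** D)"

lemma quartic_trace_eq_sum:
  "quartic_trace n H A B C D =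
     (\<Sum>i=1..n. \<Sum>j=1..n. trace (H i ** A ** H j ** B ** H i ** C ** H j ** D))"
  by (simp add: quartic_trace_def quartic_def matrix_mult_sum_left trace_sum)

text \<open>Rotating the trace by one block exchanges the roles of the two summation indices, which
  the double sum does not see. Properties of one slot thus transport to all four.\<close>

lemma quartic_trace_cyclic: "quartic_trace n H A B C D = quartic_trace n H B C D A"
proof -
  have "trace (H i ** A ** H j ** B ** H i ** C ** H j ** D) =
      trace (H j ** B ** H i ** C ** H j ** D ** H i ** A)" for i j
    using trace_mul_sym[of "H i ** A" "H j ** B ** H i ** C ** H j ** D"]
    by (simp add: matrix_mul_assoc)
  then show ?thesis
    unfolding quartic_trace_eq_sum by (subst sum.swap) simp
qed

lemma quartic_trace_linear1:
  "quartic_trace n H (a *\<^sub>R A + b *\<^sub>R A') B C D =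
     of_real a * quartic_trace n H A B C D + of_real b * quartic_trace n H A' B C D"
  unfolding quartic_trace_eq_sum
  by (simp add: matrix_add_ldistrib matrix_mult_add_left matrix_mult_scaleR_left matrix_mult_scaleR_right
      trace_add trace_scaleR sum.distrib sum_distrib_left)

lemma spectral_mat_linear:
  "spectral_mat U (\<lambda>k. a * f k + b * g k) = a *\<^sub>R spectral_mat U f + b *\<^sub>R spectral_mat U g"
proof -
  have "diag_mat (\<lambda>k. of_real (a * f k + b * g k)) =
      a *\<^sub>R diag_mat (\<lambda>k. of_real (f k)) + b *\<^sub>R (diag_mat (\<lambda>k. of_real (g k)) :: complex^'a^'a)"
    by (simp add: vec_eq_iff diag_mat_def) (simp add: scaleR_conv_of_real)
  then show ?thesis
    by (simp add: spectral_mat_def matrix_add_ldistrib matrix_mult_add_left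
        matrix_mult_scaleR_left matrix_mult_scaleR_right)
qed

text \<open>\<open>f = cos \<phi>\<close> is the average of the unimodular functions \<open>exp (\<plusminus>\<i> \<phi>)\<close>.\<close>

lemma spectral_mat_average_unitary:
  assumes U: "unitary U" and f: "\<And>k. \<bar>f k\<bar> \<le> 1"
  shows "\<exists>Q R. unitary Q \<and> unitary R \<and> spectral_mat U f = (1/2) *\<^sub>R Q + (1/2) *\<^sub>R R"
proof -
  define V where "V s = U ** diag_mat (\<lambda>k. cis (s * arccos (f k))) ** conj_transpose U" for s :: real
  have diag: "diag_mat (\<lambda>k. cis (s * arccos (f k))) ** diag_mat (\<lambda>k. cis (- (s * arccos (f k)))) = mat 1"
    for s
    by (simp add: diag_mat_mult cis_mult) (simp add: diag_mat_def mat_def)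
  have "V s ** V (-s) = mat 1" for s
  proof -
    have "V s ** V (-s) = U ** diag_mat (\<lambda>k. cis (s * arccos (f k))) ** (conj_transpose U ** U) **
        diag_mat (\<lambda>k. cis (- (s * arccos (f k)))) ** conj_transpose U"
      by (simp only: V_def matrix_mul_assoc minus_mult_left)
    also have "\<dots> = U ** (diag_mat (\<lambda>k. cis (s * arccos (f k))) ** diag_mat (\<lambda>k. cis (- (s * arccos (f k)))))
        ** conj_transpose U"
      using U by (simp add: unitary_def matrix_mul_assoc)
    finally show ?thesis using U by (simp add: diag unitary_def)
  qed
  moreover have "conj_transpose (V s) = V (-s)" for s
    by (simp add: V_def conj_transpose_mult conj_transpose_diag_mat matrix_mul_assoc cis_cnj)
  ultimately have "unitary (V s)" for s
    unfolding unitary_def by (metis minus_minus)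
  moreover have "spectral_mat U f = (1/2) *\<^sub>R V 1 + (1/2) *\<^sub>R V (-1)"
  proof -
    have "(\<lambda>k. complex_of_real (f k)) = (\<lambda>k. (1/2) *\<^sub>R cis (arccos (f k)) + (1/2) *\<^sub>R cis (- arccos (f k)))"
      using f by (simp add: fun_eq_iff complex_eq_iff cos_arccos_abs)
    then have "diag_mat (\<lambda>k. complex_of_real (f k)) = (1/2) *\<^sub>R diag_mat (\<lambda>k. cis (1 * arccos (f k)))
        + (1/2) *\<^sub>R diag_mat (\<lambda>k. cis (-1 * arccos (f k)))"
      by (simp add: diag_mat_def vec_eq_iff)
    then show ?thesis
      by (simp add: spectral_mat_def V_def matrix_add_ldistrib matrix_mult_add_left
          matrix_mult_scaleR_left matrix_mult_scaleR_right)
  qed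
  ultimately show ?thesis by blast
qed

text \<open>Fixes the four eigenbases and keeps the eigenvalue functions as variables: the form is
  multilinear in real functions, which can be altered entry by entry.\<close>

definition spectral_quartic :: "nat \<Rightarrow> (nat \<Rightarrow> complex^'d^'d) \<Rightarrow>
    complex^'d^'d \<Rightarrow> complex^'d^'d \<Rightarrow> complex^'d^'d \<Rightarrow> complex^'d^'d \<Rightarrow>
    ('d \<Rightarrow> real) \<Rightarrow> ('d \<Rightarrow> real) \<Rightarrow> ('d \<Rightarrow> real) \<Rightarrow> ('d \<Rightarrow> real) \<Rightarrow> complex" where
  "spectral_quartic n H U1 U2 U3 U4 f g h l =
     quartic_trace n H (spectral_mat U1 f) (spectral_mat U2 g) (spectral_mat U3 h) (spectral_mat U4 l)"

lemma norm_average_le: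
  fixes x y :: complex
  shows "norm x \<le> b \<Longrightarrow> norm y \<le> b \<Longrightarrow> norm (of_real (1/2) * x + of_real (1/2) * y) \<le> b"
  by (rule order_trans[OF norm_triangle_ineq]) (simp add: norm_mult)

context
  fixes n :: nat and H :: "nat \<Rightarrow> complex^'d^'d" and W :: real
  assumes W: "\<And>Q1 Q2 Q3. unitary Q1 \<Longrightarrow> unitary Q2 \<Longrightarrow> unitary Q3 \<Longrightarrow>
    spectral_norm (quartic n H Q1 Q2 Q3) \<le> W"
begin

text \<open>Each contraction is an average of two unitaries, and cyclicity moves its slot to the
  front, where linearity applies. The fourth slot enters through trace duality.\<close>

lemma quartic_trace_contraction_bound:
  assumes U: "unitary U1" "unitary U2" "unitary U3" "unitary U4"
    and c: "\<And>k. \<bar>f k\<bar> \<le> 1" "\<And>k. \<bar>g k\<bar> \<le> 1" "\<And>k. \<bar>h k\<bar> \<le> 1"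
  shows "norm (quartic_trace n H (spectral_mat U1 f) (spectral_mat U2 g) (spectral_mat U3 h)
      (spectral_mat U4 l)) \<le> W * (\<Sum>k\<in>UNIV. \<bar>l k\<bar>)"
    (is "norm (quartic_trace n H ?F ?G ?K ?L) \<le> ?b")
proof -
  have 0: "norm (quartic_trace n H Q1 Q2 Q3 ?L) \<le> ?b" if "unitary Q1" "unitary Q2" "unitary Q3" for Q1 Q2 Q3
    unfolding quartic_trace_def
    by (rule order_trans[OF norm_trace_mult_spectral_mat_le[OF U(4)] mult_right_mono[OF W[OF that]]])
       (simp add: sum_nonneg)
  have avg: "norm (quartic_trace n H (spectral_mat V f) B C D) \<le> b"
    if that1: "\<And>Q. unitary Q \<Longrightarrow> norm (quartic_trace n H Q B C D) \<le> b"
      and that2: "\<And>k. \<bar>f k\<bar> \<le> 1" and V: "unitary V" for V f B C D b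
  proof -
    obtain Q R where "unitary Q" "unitary R" "spectral_mat V f = (1/2) *\<^sub>R Q + (1/2) *\<^sub>R R"
      using spectral_mat_average_unitary[of V f, OF V that2] by (elim exE conjE)
    then show ?thesis using that1 by (simp only: quartic_trace_linear1) (intro norm_average_le)
  qed
  have 1: "norm (quartic_trace n H ?F Q2 Q3 ?L) \<le> ?b" if "unitary Q2" "unitary Q3" for Q2 Q3
    by (rule avg[OF _ c(1) U(1)]) (rule 0[OF _ that])
  have 2: "norm (quartic_trace n H ?F ?G Q3 ?L) \<le> ?b" if "unitary Q3" for Q3
    unfolding quartic_trace_cyclic[of n H ?F]
    by (rule avg[OF _ c(2) U(2)]) (use 1[OF _ that] in \<open>simp only: quartic_trace_cyclic[of n H ?F]\<close>)
  show ?thesis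
    unfolding quartic_trace_cyclic[of n H ?F] quartic_trace_cyclic[of n H ?G]
    by (rule avg[OF _ c(3) U(3)])
       (use 2 in \<open>simp only: quartic_trace_cyclic[of n H ?F] quartic_trace_cyclic[of n H ?G]\<close>)
qed

text \<open>The endpoint of a Hoelder type inequality: sup norms on three slots, an l1 norm on the
  fourth. It follows from the contraction case by homogeneity.\<close>

lemma spectral_quartic_bound4:
  assumes U: "unitary U1" "unitary U2" "unitary U3" "unitary U4"
    and c: "\<And>k. \<bar>f k\<bar> \<le> a" "\<And>k. \<bar>g k\<bar> \<le> b" "\<And>k. \<bar>h k\<bar> \<le> c" and pos: "a > 0" "b > 0" "c > 0"
  shows "norm (spectral_quartic n H U1 U2 U3 U4 f g h l) \<le> W * (a * b * c * (\<Sum>k\<in>UNIV. \<bar>l k\<bar>))"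
proof -
  have sc: "quartic_trace n H (spectral_mat V u) B C D =
      of_real r * quartic_trace n H (spectral_mat V (\<lambda>k. u k / r)) B C D" if "r > 0" for V u B C D r
  proof -
    have "spectral_mat V u = r *\<^sub>R spectral_mat V (\<lambda>k. u k / r) + 0 *\<^sub>R spectral_mat V (\<lambda>k. 0)"
      unfolding spectral_mat_linear[symmetric] using that by simp
    then show ?thesis by (simp only: quartic_trace_linear1) simp
  qed
  let ?F = "spectral_mat U1 (\<lambda>k. f k / a)" and ?G = "spectral_mat U2 (\<lambda>k. g k / b)"
    and ?K = "spectral_mat U3 (\<lambda>k. h k / c)" and ?L = "spectral_mat U4 l"
  have "spectral_quartic n H U1 U2 U3 U4 f g h l = of_real (a * b * c) * quartic_trace n H ?F ?G ?K ?L"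
    unfolding spectral_quartic_def
    unfolding sc[OF pos(1), of U1 f] quartic_trace_cyclic[of n H ?F]
    unfolding sc[OF pos(2), of U2 g] quartic_trace_cyclic[of n H ?G]
    unfolding sc[OF pos(3), of U3 h] by (simp add: mult_ac)
  also have "norm \<dots> \<le> a * b * c * (W * (\<Sum>k\<in>UNIV. \<bar>l k\<bar>))"
    unfolding norm_mult
    using pos c by (intro mult_mono quartic_trace_contraction_bound[OF U]) (auto simp: divide_le_eq norm_mult)
  finally show ?thesis by (simp add: mult_ac)
qed

end

lemma spectral_quartic_cyclic:
  "spectral_quartic n H U1 U2 U3 U4 f g h l = spectral_quartic n H U2 U3 U4 U1 g h l f"
  unfolding spectral_quartic_def by (rule quartic_trace_cyclic)

lemma spectral_quartic_diff1:
  "spectral_quartic n H U1 U2 U3 U4 (\<lambda>k. f k - f' k) g h l =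
     spectral_quartic n H U1 U2 U3 U4 f g h l - spectral_quartic n H U1 U2 U3 U4 f' g h l"
  using spectral_mat_linear[of U1 1 f "-1" f']
    quartic_trace_linear1[of n H 1 "spectral_mat U1 f" "-1" "spectral_mat U1 f'"]
  by (simp add: spectral_quartic_def)

lemma spectral_quartic_diff4:
  "spectral_quartic n H U1 U2 U3 U4 f g h (\<lambda>k. l k - l' k) =
     spectral_quartic n H U1 U2 U3 U4 f g h l - spectral_quartic n H U1 U2 U3 U4 f g h l'"
  unfolding spectral_quartic_cyclic[of n H U4, symmetric] by (rule spectral_quartic_diff1)

text \<open>Telescoping, one slot at a time. Each increment is rotated into the last slot, the one
  measured by the l1 norm.\<close>

lemma spectral_quartic_diff:
  "spectral_quartic n H U1 U2 U3 U4 f g h l - spectral_quartic n H U1 U2 U3 U4 f' g' h' l' =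
     spectral_quartic n H U2 U3 U4 U1 g h l (\<lambda>k. f k - f' k) +
     spectral_quartic n H U3 U4 U1 U2 h l f' (\<lambda>k. g k - g' k) +
     spectral_quartic n H U4 U1 U2 U3 l f' g' (\<lambda>k. h k - h' k) +
     spectral_quartic n H U1 U2 U3 U4 f' g' h' (\<lambda>k. l k - l' k)"
  unfolding spectral_quartic_diff4
  by (simp add: spectral_quartic_cyclic[of n H U1] spectral_quartic_cyclic[of n H U2]
      spectral_quartic_cyclic[of n H U3])

text \<open>One peeling step: only entries at the top level \<open>b\<close> move, and they keep
  their sign, so that the change of a power is exactly \<open>b ^ e - s ^ e\<close> in absolute
  value.\<close>

definition lower_top :: "real \<Rightarrow> real \<Rightarrow> real \<Rightarrow> real" where
  "lower_top b s u = (if \<bar>u\<bar> = b then sgn u * s else u)"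

lemma abs_lower_top_le: "0 \<le> s \<Longrightarrow> s \<le> b \<Longrightarrow> \<bar>u\<bar> \<le> b \<Longrightarrow> \<bar>lower_top b s u\<bar> \<le> b"
  by (auto simp: lower_top_def abs_mult sgn_if)

text \<open>At the top level this reads \<open>b ^ r * (b ^ e - s ^ e) \<le> b ^ N - s ^ N\<close>,
  true because \<open>s ^ r \<le> b ^ r\<close>. The factor \<open>b ^ r\<close> stands for the sup
  norms of the other three slots.\<close>

lemma lower_top_power_diff:
  assumes b: "0 < b" and s: "0 \<le> s" "s \<le> b" and N: "N = e + r"
  shows "b ^ r * \<bar>u ^ e - lower_top b s u ^ e\<bar> \<le> \<bar>u\<bar> ^ N - \<bar>lower_top b s u\<bar> ^ N"
proof (cases "\<bar>u\<bar> = b")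
  case True
  then have u: "u = sgn u * b" and sg: "\<bar>sgn u\<bar> = 1" using b by (auto simp: sgn_if)
  have "\<bar>u ^ e - lower_top b s u ^ e\<bar> = \<bar>sgn u ^ e * (b ^ e - s ^ e)\<bar>"
    using True by (subst u) (simp add: lower_top_def power_mult_distrib algebra_simps)
  also have "\<dots> = b ^ e - s ^ e"
    using sg s power_mono[OF s(2) s(1), of e] by (simp add: abs_mult power_abs)
  finally have eq: "\<bar>u ^ e - lower_top b s u ^ e\<bar> = b ^ e - s ^ e" .
  have "b ^ r * \<bar>u ^ e - lower_top b s u ^ e\<bar> = b ^ N - b ^ r * s ^ e"
    unfolding eq by (simp add: N power_add algebra_simps)
  moreover have "s ^ N \<le> b ^ r * s ^ e"
    unfolding N power_add mult.commute[of "b ^ r"] using s by (intro mult_left_mono power_mono) auto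
  ultimately show ?thesis
    using True sg s by (simp add: lower_top_def abs_mult)
qed (simp add: lower_top_def)

context
  fixes n :: nat and H :: "nat \<Rightarrow> complex^'d^'d" and W :: real
  assumes W: "\<And>Q1 Q2 Q3. unitary Q1 \<Longrightarrow> unitary Q2 \<Longrightarrow> unitary Q3 \<Longrightarrow>
    spectral_norm (quartic n H Q1 Q2 Q3) \<le> W"
begin

lemma quartic_bound_nonneg: "0 \<le> W"
proof -
  have "unitary (mat 1 :: complex^'d^'d)"
    by (simp add: unitary_def vec_eq_iff matrix_mult_nth) (simp add: mat_def if_distrib cong: if_cong)
  then show ?thesis using W[of "mat 1" "mat 1" "mat 1"] spectral_norm_nonneg order_trans by blast
qed

lemma spectral_quartic_lower_top_le:
  assumes U: "unitary U1" "unitary U2" "unitary U3" "unitary U4"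
    and b: "0 < b" and s: "0 \<le> s" "s \<le> b"
    and x: "\<And>k. \<bar>x1 k\<bar> \<le> b" "\<And>k. \<bar>x2 k\<bar> \<le> b" "\<And>k. \<bar>x3 k\<bar> \<le> b"
    and N: "N = e1 + e2 + e3 + e4"
  shows "norm (spectral_quartic n H U1 U2 U3 U4 (\<lambda>k. x1 k ^ e1) (\<lambda>k. x2 k ^ e2) (\<lambda>k. x3 k ^ e3)
      (\<lambda>k. x4 k ^ e4 - lower_top b s (x4 k) ^ e4))
    \<le> W * (\<Sum>k\<in>UNIV. \<bar>x4 k\<bar> ^ N - \<bar>lower_top b s (x4 k)\<bar> ^ N)"
proof -
  have pw: "\<bar>u ^ e\<bar> \<le> b ^ e" if "\<bar>u\<bar> \<le> b" for u :: real and e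
    using power_mono[OF that] by (simp add: power_abs)
  have "norm (spectral_quartic n H U1 U2 U3 U4 (\<lambda>k. x1 k ^ e1) (\<lambda>k. x2 k ^ e2) (\<lambda>k. x3 k ^ e3)
      (\<lambda>k. x4 k ^ e4 - lower_top b s (x4 k) ^ e4))
    \<le> W * (b ^ e1 * b ^ e2 * b ^ e3 * (\<Sum>k\<in>UNIV. \<bar>x4 k ^ e4 - lower_top b s (x4 k) ^ e4\<bar>))"
    by (rule spectral_quartic_bound4[OF W U]) (use b in \<open>auto intro: pw x\<close>)
  also have "b ^ e1 * b ^ e2 * b ^ e3 * (\<Sum>k\<in>UNIV. \<bar>x4 k ^ e4 - lower_top b s (x4 k) ^ e4\<bar>) =
      (\<Sum>k\<in>UNIV. b ^ (e1 + e2 + e3) * \<bar>x4 k ^ e4 - lower_top b s (x4 k) ^ e4\<bar>)"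
    by (simp add: sum_distrib_left power_add)
  also have "W * \<dots> \<le> W * (\<Sum>k\<in>UNIV. \<bar>x4 k\<bar> ^ N - \<bar>lower_top b s (x4 k)\<bar> ^ N)"
    by (intro mult_left_mono quartic_bound_nonneg sum_mono lower_top_power_diff[OF b s]) (simp add: N)
  finally show ?thesis .
qed

text \<open>A substitute for complex interpolation. Lowering the largest absolute value \<open>b\<close> occurring
  among all the \<open>x\<^sub>i k\<close> to the next one changes the left-hand side by at most
  \<open>W (b\<^sup>N - s\<^sup>N)\<close> per affected entry, which is what the right-hand side loses.\<close>

lemma spectral_quartic_powers_le:
  assumes U: "unitary U1" "unitary U2" "unitary U3" "unitary U4"
  shows "norm (spectral_quartic n H U1 U2 U3 U4 (\<lambda>k. x1 k ^ e1) (\<lambda>k. x2 k ^ e2) (\<lambda>k. x3 k ^ e3) (\<lambda>k. x4 k ^ e4))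
    \<le> W * ((\<Sum>k\<in>UNIV. \<bar>x1 k\<bar> ^ (e1 + e2 + e3 + e4)) + (\<Sum>k\<in>UNIV. \<bar>x2 k\<bar> ^ (e1 + e2 + e3 + e4)) +
        (\<Sum>k\<in>UNIV. \<bar>x3 k\<bar> ^ (e1 + e2 + e3 + e4)) + (\<Sum>k\<in>UNIV. \<bar>x4 k\<bar> ^ (e1 + e2 + e3 + e4)))"
proof -
  define N where "N = e1 + e2 + e3 + e4"
  define T where "T x1 x2 x3 x4 = spectral_quartic n H U1 U2 U3 U4
    (\<lambda>k. x1 k ^ e1) (\<lambda>k. x2 k ^ e2) (\<lambda>k. x3 k ^ e3) (\<lambda>k. x4 k ^ e4)" for x1 x2 x3 x4
  define S where "S x = (\<Sum>k\<in>(UNIV::'d set). \<bar>x k\<bar> ^ N)" for x :: "'d \<Rightarrow> real"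
  have "norm (T x1 x2 x3 x4) \<le> W * (S x1 + S x2 + S x3 + S x4)"
    if "finite A" "\<forall>a\<in>A. 0 < a"
      "\<forall>k. \<bar>x1 k\<bar> \<in> insert 0 A \<and> \<bar>x2 k\<bar> \<in> insert 0 A \<and> \<bar>x3 k\<bar> \<in> insert 0 A \<and> \<bar>x4 k\<bar> \<in> insert 0 A"
    for A :: "real set" and x1 x2 x3 x4
    using that
  proof (induction A arbitrary: x1 x2 x3 x4 rule: finite_linorder_max_induct)
    case empty
    then have x: "x1 = (\<lambda>k. 0)" "x2 = (\<lambda>k. 0)" "x3 = (\<lambda>k. 0)" "x4 = (\<lambda>k. 0)" by auto
    \<comment> \<open>All entries vanish, and by \<open>0 ^ 0 = 1\<close> a slot is constantly 1 or
      0 according to its exponent. If \<open>N = 0\<close> every slot is 1; otherwise some exponent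
      is positive and that slot, rotated to the end, annihilates the form.\<close>
    have 0: "\<bar>(0::real) ^ e\<bar> \<le> 1" for e by (simp add: power_0_left)
    have bound: "norm (spectral_quartic n H V1 V2 V3 V4 (\<lambda>k. 0 ^ p) (\<lambda>k. 0 ^ q) (\<lambda>k. 0 ^ r) (\<lambda>k. 0 ^ t))
        \<le> W * (\<Sum>k\<in>(UNIV::'d set). \<bar>0 ^ t\<bar>)"
      if "unitary V1" "unitary V2" "unitary V3" "unitary V4" for V1 V2 V3 V4 p q r t
      using spectral_quartic_bound4[OF W that, of "\<lambda>k. 0 ^ p" 1 "\<lambda>k. 0 ^ q" 1 "\<lambda>k. 0 ^ r" 1 "\<lambda>k. 0 ^ t"] 0
      by simp
    have e4: "norm (T x1 x2 x3 x4) \<le> W * (\<Sum>k\<in>(UNIV::'d set). \<bar>0 ^ e4\<bar>)"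
      unfolding T_def x by (rule bound[OF U])
    have e1: "norm (T x1 x2 x3 x4) \<le> W * (\<Sum>k\<in>(UNIV::'d set). \<bar>0 ^ e1\<bar>)"
      unfolding T_def x by (subst spectral_quartic_cyclic) (rule bound[OF U(2,3,4,1)])
    have e2: "norm (T x1 x2 x3 x4) \<le> W * (\<Sum>k\<in>(UNIV::'d set). \<bar>0 ^ e2\<bar>)"
      unfolding T_def x by (subst spectral_quartic_cyclic, subst spectral_quartic_cyclic) (rule bound[OF U(3,4,1,2)])
    have e3: "norm (T x1 x2 x3 x4) \<le> W * (\<Sum>k\<in>(UNIV::'d set). \<bar>0 ^ e3\<bar>)"
      unfolding T_def x by (subst spectral_quartic_cyclic[symmetric]) (rule bound[OF U(4,1,2,3)])
    show ?case
    proof (cases "N = 0")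
      case True
      then have "W * (\<Sum>k\<in>(UNIV::'d set). \<bar>0 ^ e4\<bar>) \<le> W * (S x1 + S x2 + S x3 + S x4)"
        using quartic_bound_nonneg by (intro mult_left_mono) (auto simp: S_def N_def)
      with e4 show ?thesis by linarith
    next
      case False
      then consider "e1 \<noteq> 0" | "e2 \<noteq> 0" | "e3 \<noteq> 0" | "e4 \<noteq> 0" by (auto simp: N_def)
      then have "norm (T x1 x2 x3 x4) \<le> 0"
        by cases (use e1 e2 e3 e4 in \<open>simp_all only: power_0_left if_False abs_zero sum.neutral_const mult_zero_right\<close>)
      also have "0 \<le> W * (S x1 + S x2 + S x3 + S x4)"
        using quartic_bound_nonneg by (simp add: S_def sum_nonneg)
      finally show ?thesis .
    qed
  next
    case (insert b A)
    \<comment> \<open>The next lower level, or 0 when \<open>b\<close> was the only one left. After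
      lowering, all absolute values lie in \<open>insert 0 A\<close>.\<close>
    define s where "s = Max (insert 0 A)"
    have s_in: "s \<in> insert 0 A" unfolding s_def using insert.hyps by (intro Max_in) auto
    have b: "0 < b" using insert.prems by simp
    have s: "0 \<le> s" "s \<le> b"
      using s_in insert.hyps b insert.prems by (auto intro: less_imp_le)
    have A_le: "\<forall>a\<in>insert 0 (insert b A). a \<le> b" using insert.hyps b by (auto intro: less_imp_le)
    define y where "y x = (\<lambda>k. lower_top b s (x k))" for x :: "'d \<Rightarrow> real"
    have xb: "\<bar>x1 k\<bar> \<le> b" "\<bar>x2 k\<bar> \<le> b" "\<bar>x3 k\<bar> \<le> b" "\<bar>x4 k\<bar> \<le> b" for k
      using insert.prems(2) A_le by blast+
    have yb: "\<bar>y x1 k\<bar> \<le> b" "\<bar>y x2 k\<bar> \<le> b" "\<bar>y x3 k\<bar> \<le> b" for k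
      unfolding y_def by (intro abs_lower_top_le s xb)+
    have low: "\<bar>lower_top b s u\<bar> \<in> insert 0 A" if "\<bar>u\<bar> \<in> insert 0 (insert b A)" for u
      using that s_in s b by (auto simp: lower_top_def abs_mult sgn_if)
    have IH: "norm (T (y x1) (y x2) (y x3) (y x4)) \<le> W * (S (y x1) + S (y x2) + S (y x3) + S (y x4))"
      using insert.prems by (intro insert.IH) (auto simp: y_def intro!: low[simplified])
    have S_diff: "(\<Sum>k\<in>UNIV. \<bar>x k\<bar> ^ N - \<bar>lower_top b s (x k)\<bar> ^ N) = S x - S (y x)" for x
      by (simp add: S_def y_def sum_subtractf)
    note step = spectral_quartic_lower_top_le[OF _ _ _ _ b s, where N = N]
    have T_diff: "T x1 x2 x3 x4 - T (y x1) (y x2) (y x3) (y x4) =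
        spectral_quartic n H U2 U3 U4 U1 (\<lambda>k. x2 k ^ e2) (\<lambda>k. x3 k ^ e3) (\<lambda>k. x4 k ^ e4)
          (\<lambda>k. x1 k ^ e1 - lower_top b s (x1 k) ^ e1) +
        spectral_quartic n H U3 U4 U1 U2 (\<lambda>k. x3 k ^ e3) (\<lambda>k. x4 k ^ e4) (\<lambda>k. y x1 k ^ e1)
          (\<lambda>k. x2 k ^ e2 - lower_top b s (x2 k) ^ e2) +
        spectral_quartic n H U4 U1 U2 U3 (\<lambda>k. x4 k ^ e4) (\<lambda>k. y x1 k ^ e1) (\<lambda>k. y x2 k ^ e2)
          (\<lambda>k. x3 k ^ e3 - lower_top b s (x3 k) ^ e3) +
        spectral_quartic n H U1 U2 U3 U4 (\<lambda>k. y x1 k ^ e1) (\<lambda>k. y x2 k ^ e2) (\<lambda>k. y x3 k ^ e3)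
          (\<lambda>k. x4 k ^ e4 - lower_top b s (x4 k) ^ e4)"
      unfolding T_def y_def by (rule spectral_quartic_diff)
    have "norm (T x1 x2 x3 x4 - T (y x1) (y x2) (y x3) (y x4)) \<le>
        W * (\<Sum>k\<in>UNIV. \<bar>x1 k\<bar> ^ N - \<bar>lower_top b s (x1 k)\<bar> ^ N) +
        W * (\<Sum>k\<in>UNIV. \<bar>x2 k\<bar> ^ N - \<bar>lower_top b s (x2 k)\<bar> ^ N) +
        W * (\<Sum>k\<in>UNIV. \<bar>x3 k\<bar> ^ N - \<bar>lower_top b s (x3 k)\<bar> ^ N) +
        W * (\<Sum>k\<in>UNIV. \<bar>x4 k\<bar> ^ N - \<bar>lower_top b s (x4 k)\<bar> ^ N)"
      unfolding T_diff by (intro norm_triangle_mono step U xb yb) (simp_all add: N_def)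
    also have "\<dots> = W * (S x1 + S x2 + S x3 + S x4) - W * (S (y x1) + S (y x2) + S (y x3) + S (y x4))"
      unfolding S_diff by (simp only: distrib_left right_diff_distrib)
    finally have "norm (T x1 x2 x3 x4 - T (y x1) (y x2) (y x3) (y x4)) \<le> \<dots>" .
    with IH norm_triangle_sub[of "T x1 x2 x3 x4" "T (y x1) (y x2) (y x3) (y x4)"]
    show ?case by linarith
  qed
  note main = this
  let ?A = "(\<Union>x\<in>{x1, x2, x3, x4}. (\<lambda>k. \<bar>x k\<bar>) ` UNIV) - {0}"
  have "norm (T x1 x2 x3 x4) \<le> W * (S x1 + S x2 + S x3 + S x4)"
    by (rule main[of ?A]) auto
  then show ?thesis unfolding T_def S_def N_def .
qed

text \<open>With two slots each for \<open>X\<close> and \<open>Z\<close> the four power sums become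
  twice each trace. The even total degree removes the absolute values.\<close>

lemma quartic_trace_matpow_le:
  assumes X: "hermitian X" and Z: "hermitian Z" and N: "a + b + c + e = 2 * m"
  shows "norm (quartic_trace n H (matpow X a) (matpow X b) (matpow Z c) (matpow Z e))
    \<le> 2 * W * (Re (trace (matpow X (2 * m))) + Re (trace (matpow Z (2 * m))))"
proof -
  obtain U f where U: "unitary U" "X = spectral_mat U f" using spectral_theorem[OF X] .
  obtain V g where V: "unitary V" "Z = spectral_mat V g" using spectral_theorem[OF Z] .
  have "Re (trace (matpow X (2 * m))) = (\<Sum>k\<in>UNIV. \<bar>f k\<bar> ^ (2 * m))"
    unfolding U(2) matpow_spectral_mat[OF U(1)] trace_spectral_mat[OF U(1)] by (simp add: power_even_abs)
  moreover have "Re (trace (matpow Z (2 * m))) = (\<Sum>k\<in>UNIV. \<bar>g k\<bar> ^ (2 * m))"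
    unfolding V(2) matpow_spectral_mat[OF V(1)] trace_spectral_mat[OF V(1)] by (simp add: power_even_abs)
  moreover have "quartic_trace n H (matpow X a) (matpow X b) (matpow Z c) (matpow Z e) =
      spectral_quartic n H U U V V (\<lambda>k. f k ^ a) (\<lambda>k. f k ^ b) (\<lambda>k. g k ^ c) (\<lambda>k. g k ^ e)"
    unfolding U(2) V(2) spectral_quartic_def matpow_spectral_mat[OF U(1)] matpow_spectral_mat[OF V(1)] ..
  ultimately show ?thesis
    using spectral_quartic_powers_le[OF U(1) U(1) V(1) V(1), of f a f b g c g e] N
    by (simp add: algebra_simps)
qed

end

section \<open>Polynomials in independent standard normal variables\<close>

definition gauss_moment :: "nat \<Rightarrow> real" where
  "gauss_moment m = (LINT x|lborel. std_normal_density x * x ^ m)"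

lemma gauss_moment_even: "gauss_moment (2 * k) = fact (2 * k) / (2 ^ k * fact k)"
  unfolding gauss_moment_def by (rule integral_std_normal_moment_even)

lemma gauss_moment_odd: "gauss_moment (2 * k + 1) = 0"
  unfolding gauss_moment_def by (rule integral_std_normal_moment_odd)

text \<open>One-dimensional integration by parts, read off from the closed forms of the moments. At
  \<open>m = 0\<close> the factor \<open>real m\<close> makes the truncated \<open>m - 1\<close>
  harmless.\<close>

lemma gauss_moment_Suc: "gauss_moment (Suc m) = real m * gauss_moment (m - 1)"
proof (cases "even m")
  case True
  then obtain k where m: "m = 2 * k" by (elim evenE)
  show ?thesis
  proof (cases k)
    case 0
    then show ?thesis using gauss_moment_odd[of 0] m by simp
  next
    case (Suc j)
    then show ?thesis using gauss_moment_odd[of k] gauss_moment_odd[of j] m by simp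
  qed
next
  case False
  then obtain k where m: "m = 2 * k + 1" by (elim oddE)
  have "gauss_moment (Suc m) = (2 * (real k + 1) * ((2 * real k + 1) * fact (2 * k))) / (2 * (real k + 1) * (2 ^ k * fact k))"
    using gauss_moment_even[of "Suc k"] by (simp add: m algebra_simps)
  also have "\<dots> = ((2 * real k + 1) * fact (2 * k)) / (2 ^ k * fact k)"
    by (rule nonzero_mult_divide_mult_cancel_left) simp
  finally show ?thesis using gauss_moment_even[of k] by (simp add: m)
qed

text \<open>Independent standard normal variables enter only through their joint moments.\<close>

locale gaussian_family = prob_space P for P :: "'a measure" +
  fixes I :: "'i set" and z :: "'i \<Rightarrow> 'a \<Rightarrow> real"
  assumes finite_I: "finite I"
    and integrable_monomial: "\<And>m. integrable P (\<lambda>\<omega>. \<Prod>k\<in>I. z k \<omega> ^ m k)"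
    and expectation_monomial: "\<And>m. (LINT \<omega>|P. (\<Prod>k\<in>I. z k \<omega> ^ m k)) = (\<Prod>k\<in>I. gauss_moment (m k))"
begin

section \<open>Integration by parts for Gaussian polynomials\<close>

definition mon :: "('i \<Rightarrow> nat) \<Rightarrow> 'a \<Rightarrow> real" where
  "mon m \<omega> = (\<Prod>k\<in>I. z k \<omega> ^ m k)"

text \<open>The derivative of the monomial in the direction \<open>v\<close>. Where
  \<open>m k - 1\<close> truncates, the factor \<open>real (m k)\<close> is zero.\<close>

definition dmon :: "('i \<Rightarrow> real) \<Rightarrow> ('i \<Rightarrow> nat) \<Rightarrow> 'a \<Rightarrow> real" where
  "dmon v m \<omega> = (\<Sum>k\<in>I. v k * real (m k) * mon (m(k := m k - 1)) \<omega>)"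

text \<open>The functional dual to the direction \<open>v\<close>: under the expectation,
  multiplying by it amounts to differentiating along \<open>v\<close>.\<close>

definition lin :: "('i \<Rightarrow> real) \<Rightarrow> 'a \<Rightarrow> real" where
  "lin v \<omega> = (\<Sum>k\<in>I. v k * z k \<omega>)"

lemma mon_mult: "mon m \<omega> * mon m' \<omega> = mon (\<lambda>k. m k + m' k) \<omega>"
  by (simp add: mon_def power_add prod.distrib)

lemma mon_0: "mon (\<lambda>_. 0) \<omega> = 1"
  by (simp add: mon_def)

lemma dmon_0: "dmon v (\<lambda>_. 0) \<omega> = 0"
  by (simp add: dmon_def)

lemma mon_upd: "k \<in> I \<Longrightarrow> mon (m(k := e)) \<omega> = z k \<omega> ^ e * (\<Prod>i\<in>I - {k}. z i \<omega> ^ m i)"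
  unfolding mon_def by (subst prod.remove[OF finite_I]) (auto intro!: prod.cong)

lemma dmon_mult: "dmon v (\<lambda>k. m k + m' k) \<omega> = dmon v m \<omega> * mon m' \<omega> + mon m \<omega> * dmon v m' \<omega>"
proof -
  \<comment> \<open>For \<open>a k = 0\<close>, truncated subtraction does not commute with adding
    \<open>b k\<close>; the factor \<open>real (a k)\<close> covers that case.\<close>
  have shift: "real (a k) * mon (\<lambda>i. (a(k := a k - 1)) i + b i) \<omega> =
      real (a k) * mon ((\<lambda>i. a i + b i)(k := a k + b k - 1)) \<omega>" for a b :: "'i \<Rightarrow> nat" and k
  proof (cases "a k = 0")
    case False
    then have "(\<lambda>i. (a(k := a k - 1)) i + b i) = (\<lambda>i. a i + b i)(k := a k + b k - 1)"
      by (auto simp: fun_eq_iff)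
    then show ?thesis by simp
  qed simp
  have "v k * real (m k + m' k) * mon ((\<lambda>i. m i + m' i)(k := m k + m' k - 1)) \<omega> =
      v k * real (m k) * mon (m(k := m k - 1)) \<omega> * mon m' \<omega> +
      mon m \<omega> * (v k * real (m' k) * mon (m'(k := m' k - 1)) \<omega>)" for k
  proof -
    let ?M = "mon ((\<lambda>i. m i + m' i)(k := m k + m' k - 1)) \<omega>"
    have 1: "real (m k) * ?M = real (m k) * (mon (m(k := m k - 1)) \<omega> * mon m' \<omega>)"
      using shift[of m k m'] by (simp only: mon_mult)
    have "(\<lambda>i. m' i + m i) = (\<lambda>i. m i + m' i)" by (simp add: add.commute)
    then have 2: "real (m' k) * ?M = real (m' k) * (mon (m'(k := m' k - 1)) \<omega> * mon m \<omega>)"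
      using shift[of m' k m] by (simp only: mon_mult add.commute[of "m' k"])
    have "v k * real (m k + m' k) * ?M = v k * (real (m k) * ?M) + v k * (real (m' k) * ?M)"
      by (simp only: of_nat_add distrib_left distrib_right mult.assoc)
    then show ?thesis unfolding 1 2 by (simp only: mult_ac)
  qed
  then show ?thesis
    by (simp only: dmon_def sum_distrib_left sum_distrib_right sum.distrib)
qed

lemma integrable_mon: "integrable P (mon m)"
  unfolding mon_def by (rule integrable_monomial)

lemma integrable_dmon: "integrable P (dmon v m)"
  unfolding dmon_def by (intro Bochner_Integration.integrable_sum integrable_mult_right integrable_mon)

lemma lin_mult_mon: "lin v \<omega> * mon m \<omega> = (\<Sum>k\<in>I. v k * mon (m(k := Suc (m k))) \<omega>)"
proof -
  have "z k \<omega> * mon m \<omega> = mon (m(k := Suc (m k))) \<omega>" if "k \<in> I" for k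
    using mon_upd[OF that, of m "m k"] mon_upd[OF that, of m "Suc (m k)"] by simp
  then show ?thesis
    by (simp add: lin_def sum_distrib_right mult.assoc)
qed

lemma expectation_mon_Suc:
  assumes "k \<in> I"
  shows "expectation (mon (m(k := Suc (m k)))) = real (m k) * expectation (mon (m(k := m k - 1)))"
proof -
  have "expectation (mon (m(k := e))) = gauss_moment e * (\<Prod>i\<in>I - {k}. gauss_moment (m i))" for e
  proof -
    have "(\<Prod>i\<in>I - {k}. gauss_moment ((m(k := e)) i)) = (\<Prod>i\<in>I - {k}. gauss_moment (m i))"
      by (rule prod.cong) auto
    then show ?thesis
      unfolding mon_def expectation_monomial
      using prod.remove[OF finite_I assms, of "\<lambda>i. gauss_moment ((m(k := e)) i)"] by simp
  qed
  then show ?thesis by (simp add: gauss_moment_Suc)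
qed

lemma expectation_lin_mult_mon: "expectation (\<lambda>\<omega>. lin v \<omega> * mon m \<omega>) = expectation (dmon v m)"
  unfolding lin_mult_mon dmon_def
  by (simp add: Bochner_Integration.integral_sum integrable_mon expectation_mon_Suc mult.assoc)

lemma integrable_lin_mult_mon: "integrable P (\<lambda>\<omega>. lin v \<omega> * mon m \<omega>)"
  unfolding lin_mult_mon by (intro Bochner_Integration.integrable_sum integrable_mult_right integrable_mon)

text \<open>\<open>gpoly v F F' J\<close>: \<open>F\<close> is a polynomial in the Gaussian variables with coefficients depending
  differentiably on a parameter, \<open>F'\<close> its derivative in the parameter and \<open>J\<close> its derivative in the
  direction \<open>v\<close> (which may also depend on the parameter).\<close>

inductive gpoly :: "(real \<Rightarrow> 'i \<Rightarrow> real) \<Rightarrow> (real \<Rightarrow> 'a \<Rightarrow> complex) \<Rightarrow> (real \<Rightarrow> 'a \<Rightarrow> complex) \<Rightarrow>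
    (real \<Rightarrow> 'a \<Rightarrow> complex) \<Rightarrow> bool" for v where
  zero: "gpoly v (\<lambda>_ _. 0) (\<lambda>_ _. 0) (\<lambda>_ _. 0)"
| step: "gpoly v F F' J \<Longrightarrow> (\<And>t. (u has_vector_derivative u' t) (at t)) \<Longrightarrow>
    gpoly v (\<lambda>t \<omega>. u t * of_real (mon m \<omega>) + F t \<omega>) (\<lambda>t \<omega>. u' t * of_real (mon m \<omega>) + F' t \<omega>)
      (\<lambda>t \<omega>. u t * of_real (dmon (v t) m \<omega>) + J t \<omega>)"

lemma gpoly_cong:
  assumes "gpoly v F F' J" "\<And>t \<omega>. G t \<omega> = F t \<omega>" "\<And>t \<omega>. G' t \<omega> = F' t \<omega>" "\<And>t \<omega>. K t \<omega> = J t \<omega>"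
  shows "gpoly v G G' K"
proof -
  have "G = F" "G' = F'" "K = J" using assms(2-) by (auto simp: fun_eq_iff)
  then show ?thesis using assms(1) by simp
qed

lemma gpoly_coeff: "(\<And>t. (u has_vector_derivative u' t) (at t)) \<Longrightarrow> gpoly v (\<lambda>t _. u t) (\<lambda>t _. u' t) (\<lambda>_ _. 0)"
  using gpoly.step[OF gpoly.zero, where u = u and u' = u' and m = "\<lambda>_. 0" and v = v] by (simp add: mon_0 dmon_0)

lemma gpoly_const: "gpoly v (\<lambda>_ _. c) (\<lambda>_ _. 0) (\<lambda>_ _. 0)"
  by (rule gpoly_coeff) simp

lemma gpoly_var:
  assumes "k \<in> I"
  shows "gpoly v (\<lambda>_ \<omega>. of_real (z k \<omega>)) (\<lambda>_ _. 0) (\<lambda>t _. of_real (v t k))"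
proof -
  let ?m = "(\<lambda>_. 0)(k := 1 :: nat)"
  have "mon ?m \<omega> = z k \<omega>" for \<omega>
    using mon_upd[OF assms, of "\<lambda>_. 0" 1] by simp
  moreover have "dmon w ?m \<omega> = w k" for w \<omega>
  proof -
    have "w i * real (?m i) * mon (?m(i := ?m i - 1)) \<omega> = (if i = k then w k else 0)" for i
    proof -
      have "(\<lambda>_. 0)(k := 0 :: nat) = (\<lambda>_. 0)" by auto
      then show ?thesis using mon_0[of \<omega>] by (cases "i = k") simp_all
    qed
    then show ?thesis unfolding dmon_def using assms by (simp add: finite_I)
  qed
  moreover have "((\<lambda>_. 1 :: complex) has_vector_derivative 0) (at t)" for t :: real by simp
  ultimately show ?thesis
    using gpoly.step[OF gpoly.zero, where u = "\<lambda>_. 1" and u' = "\<lambda>_. 0" and m = ?m and v = v] by simp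
qed

lemma gpoly_add:
  assumes "gpoly v F F' J" "gpoly v G G' K"
  shows "gpoly v (\<lambda>t \<omega>. F t \<omega> + G t \<omega>) (\<lambda>t \<omega>. F' t \<omega> + G' t \<omega>) (\<lambda>t \<omega>. J t \<omega> + K t \<omega>)"
  using assms(1)
proof induction
  case zero
  then show ?case using assms(2) by simp
next
  case (step F F' J u u' m)
  show ?case
    by (rule gpoly_cong[OF gpoly.step[OF step.IH step.hyps(2), where m = m]]) (simp_all add: add.assoc)
qed

lemma gpoly_sum:
  assumes "\<And>s. s \<in> S \<Longrightarrow> gpoly v (F s) (F' s) (J s)"
  shows "gpoly v (\<lambda>t \<omega>. \<Sum>s\<in>S. F s t \<omega>) (\<lambda>t \<omega>. \<Sum>s\<in>S. F' s t \<omega>) (\<lambda>t \<omega>. \<Sum>s\<in>S. J s t \<omega>)"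
  using assms
  by (induction S rule: infinite_finite_induct) (simp_all add: gpoly.zero gpoly_add)

lemma gpoly_mult_term:
  assumes "gpoly v F F' J" and u: "\<And>t. (u has_vector_derivative u' t) (at t)"
  shows "gpoly v (\<lambda>t \<omega>. u t * of_real (mon m \<omega>) * F t \<omega>)
    (\<lambda>t \<omega>. u' t * of_real (mon m \<omega>) * F t \<omega> + u t * of_real (mon m \<omega>) * F' t \<omega>)
    (\<lambda>t \<omega>. u t * of_real (dmon (v t) m \<omega>) * F t \<omega> + u t * of_real (mon m \<omega>) * J t \<omega>)"
  using assms(1)
proof induction
  case zero
  then show ?case by (simp add: gpoly.zero)
next
  case (step F F' J w w' m')
  have "((\<lambda>t. u t * w t) has_vector_derivative u t * w' t + u' t * w t) (at t)" for t
    by (rule has_vector_derivative_mult[OF u step.hyps(2)])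
  from gpoly.step[OF step.IH this, where m = "\<lambda>k. m k + m' k"] show ?case
    by (rule gpoly_cong) (simp_all add: dmon_mult algebra_simps flip: mon_mult)
qed

lemma gpoly_mult:
  assumes "gpoly v F F' J" "gpoly v G G' K"
  shows "gpoly v (\<lambda>t \<omega>. F t \<omega> * G t \<omega>) (\<lambda>t \<omega>. F' t \<omega> * G t \<omega> + F t \<omega> * G' t \<omega>)
    (\<lambda>t \<omega>. J t \<omega> * G t \<omega> + F t \<omega> * K t \<omega>)"
  using assms(1)
proof induction
  case zero
  then show ?case by (simp add: gpoly.zero)
next
  case (step F F' J u u' m)
  show ?case
    by (rule gpoly_cong[OF gpoly_add[OF gpoly_mult_term[OF assms(2) step.hyps(2), where m = m] step.IH]])
       (simp_all add: algebra_simps)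
qed

lemma integrable_gpoly:
  assumes "gpoly v F F' J"
  shows "integrable P (F t)" "integrable P (F' t)" "integrable P (J t)"
    "integrable P (\<lambda>\<omega>. of_real (lin w \<omega>) * F t \<omega>)"
  using assms
proof (induction)
  case (step F F' J u u' m)
  {
    case 4
    have "(\<lambda>\<omega>. complex_of_real (lin w \<omega>) * (u t * of_real (mon m \<omega>) + F t \<omega>)) =
        (\<lambda>\<omega>. u t * of_real (lin w \<omega> * mon m \<omega>) + of_real (lin w \<omega>) * F t \<omega>)"
      by (simp add: fun_eq_iff algebra_simps)
    then show ?case
      using step.IH(4) by (simp only:)
        (intro Bochner_Integration.integrable_add integrable_mult_right integrable_of_real integrable_lin_mult_mon)
  }
qed (auto intro!: Bochner_Integration.integrable_add integrable_mult_right integrable_of_real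
    integrable_mon integrable_dmon)

text \<open>The parameter sits only in the finitely many coefficients, so differentiating under the
  expectation is differentiating a finite linear combination of fixed moments.\<close>

lemma expectation_gpoly_deriv:
  assumes "gpoly v F F' J"
  shows "((\<lambda>t. LINT \<omega>|P. F t \<omega>) has_vector_derivative (LINT \<omega>|P. F' t \<omega>)) (at t)"
  using assms
proof induction
  case zero
  then show ?case by simp
next
  case (step F F' J u u' m)
  have int: "integrable P (\<lambda>\<omega>. complex_of_real (mon m \<omega>))" by (intro integrable_of_real integrable_mon)
  have eq: "(LINT \<omega>|P. c * of_real (mon m \<omega>) + G \<omega>) = c * (LINT \<omega>|P. of_real (mon m \<omega>)) + (LINT \<omega>|P. G \<omega>)"
    if "integrable P G" for c :: complex and G
    using that int by (simp add: Bochner_Integration.integral_add)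
  have "((\<lambda>t. u t * (LINT \<omega>|P. of_real (mon m \<omega>)) + (LINT \<omega>|P. F t \<omega>)) has_vector_derivative
      (u t * 0 + u' t * (LINT \<omega>|P. of_real (mon m \<omega>))) + (LINT \<omega>|P. F' t \<omega>)) (at t)"
    by (intro has_vector_derivative_add has_vector_derivative_mult step.hyps step.IH) simp
  then show ?case using integrable_gpoly(1,2)[OF step.hyps(1)] by (simp add: eq)
qed

lemma expectation_lin_mult_gpoly:
  assumes "gpoly v F F' J"
  shows "(LINT \<omega>|P. of_real (lin (v t) \<omega>) * F t \<omega>) = (LINT \<omega>|P. J t \<omega>)"
  using assms
proof induction
  case zero
  then show ?case by simp
next
  case (step F F' J u u' m)
  have int: "integrable P (\<lambda>\<omega>. complex_of_real (lin (v t) \<omega> * mon m \<omega>))"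
      "integrable P (\<lambda>\<omega>. complex_of_real (dmon (v t) m \<omega>))"
    by (intro integrable_of_real integrable_lin_mult_mon integrable_dmon)+
  have "(LINT \<omega>|P. of_real (lin (v t) \<omega>) * (u t * of_real (mon m \<omega>) + F t \<omega>)) =
      (LINT \<omega>|P. u t * of_real (lin (v t) \<omega> * mon m \<omega>) + of_real (lin (v t) \<omega>) * F t \<omega>)"
    by (simp add: algebra_simps)
  also have "\<dots> = u t * of_real (expectation (\<lambda>\<omega>. lin (v t) \<omega> * mon m \<omega>)) + (LINT \<omega>|P. J t \<omega>)"
    using int integrable_gpoly(4)[OF step.hyps(1)] step.IH
    by (subst Bochner_Integration.integral_add) (simp_all del: of_real_mult)
  also have "\<dots> = (LINT \<omega>|P. u t * of_real (dmon (v t) m \<omega>) + J t \<omega>)"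
    using int integrable_gpoly(3)[OF step.hyps(1)]
    by (subst Bochner_Integration.integral_add) (simp_all add: expectation_lin_mult_mon)
  finally show ?case .
qed

section \<open>Matrix-valued Gaussian polynomials\<close>

definition gmat :: "(real \<Rightarrow> 'i \<Rightarrow> real) \<Rightarrow> (real \<Rightarrow> 'a \<Rightarrow> complex^'d^'d) \<Rightarrow>
    (real \<Rightarrow> 'a \<Rightarrow> complex^'d^'d) \<Rightarrow> (real \<Rightarrow> 'a \<Rightarrow> complex^'d^'d) \<Rightarrow> bool" where
  "gmat v A A' J \<longleftrightarrow>
     (\<forall>i j. gpoly v (\<lambda>t \<omega>. A t \<omega> $ i $ j) (\<lambda>t \<omega>. A' t \<omega> $ i $ j) (\<lambda>t \<omega>. J t \<omega> $ i $ j))"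

lemma gmat_const: "gmat v (\<lambda>_ _. A) (\<lambda>_ _. 0) (\<lambda>_ _. 0)"
  by (simp add: gmat_def gpoly_const)

lemma gmat_mult:
  assumes "gmat v A A' J" "gmat v B B' K"
  shows "gmat v (\<lambda>t \<omega>. A t \<omega> ** B t \<omega>) (\<lambda>t \<omega>. A' t \<omega> ** B t \<omega> + A t \<omega> ** B' t \<omega>)
    (\<lambda>t \<omega>. J t \<omega> ** B t \<omega> + A t \<omega> ** K t \<omega>)"
  unfolding gmat_def
proof (intro allI)
  fix i j
  show "gpoly v (\<lambda>t \<omega>. (A t \<omega> ** B t \<omega>) $ i $ j) (\<lambda>t \<omega>. (A' t \<omega> ** B t \<omega> + A t \<omega> ** B' t \<omega>) $ i $ j)
      (\<lambda>t \<omega>. (J t \<omega> ** B t \<omega> + A t \<omega> ** K t \<omega>) $ i $ j)"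
    by (rule gpoly_cong[OF gpoly_sum[OF gpoly_mult[OF assms[unfolded gmat_def, rule_format]]]])
       (simp_all add: matrix_mult_nth sum.distrib)
qed

lemma gmat_sum:
  assumes "\<And>s. s \<in> S \<Longrightarrow> gmat v (F s) (F' s) (J s)"
  shows "gmat v (\<lambda>t \<omega>. \<Sum>s\<in>S. F s t \<omega>) (\<lambda>t \<omega>. \<Sum>s\<in>S. F' s t \<omega>) (\<lambda>t \<omega>. \<Sum>s\<in>S. J s t \<omega>)"
  using assms unfolding gmat_def by (auto intro!: gpoly_sum)

lemma gmat_scaleR:
  assumes "gpoly v (\<lambda>t \<omega>. of_real (f t \<omega>)) (\<lambda>t \<omega>. of_real (f' t \<omega>)) (\<lambda>t \<omega>. of_real (g t \<omega>))"
  shows "gmat v (\<lambda>t \<omega>. f t \<omega> *\<^sub>R A) (\<lambda>t \<omega>. f' t \<omega> *\<^sub>R A) (\<lambda>t \<omega>. g t \<omega> *\<^sub>R A)"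
  unfolding gmat_def
proof (intro allI)
  fix i j
  show "gpoly v (\<lambda>t \<omega>. (f t \<omega> *\<^sub>R A) $ i $ j) (\<lambda>t \<omega>. (f' t \<omega> *\<^sub>R A) $ i $ j) (\<lambda>t \<omega>. (g t \<omega> *\<^sub>R A) $ i $ j)"
    by (rule gpoly_cong[OF gpoly_mult[OF assms gpoly_const[of v "A $ i $ j"]]])
       (simp_all, simp_all add: scaleR_conv_of_real)
qed

lemma gpoly_trace: "gmat v A A' J \<Longrightarrow> gpoly v (\<lambda>t \<omega>. trace (A t \<omega>)) (\<lambda>t \<omega>. trace (A' t \<omega>)) (\<lambda>t \<omega>. trace (J t \<omega>))"
  unfolding trace_def gmat_def by (intro gpoly_sum) blast

end

text \<open>The derivative of the noncommutative power of order \<open>m\<close> at \<open>A\<close>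
  in the direction \<open>B\<close>. It serves both the parameter and the Gaussian
  directions.\<close>

definition matpow_deriv :: "complex^'d^'d \<Rightarrow> complex^'d^'d \<Rightarrow> nat \<Rightarrow> complex^'d^'d" where
  "matpow_deriv A B m = (\<Sum>r<m. matpow A r ** B ** matpow A (m - 1 - r))"

lemma matpow_deriv_Suc: "matpow_deriv A B (Suc m) = B ** matpow A m + A ** matpow_deriv A B m"
  unfolding matpow_deriv_def
  by (subst sum.lessThan_Suc_shift) (simp add: matrix_mult_sum_right matrix_mul_assoc)

lemma matpow_deriv_0 [simp]: "matpow_deriv A 0 m = 0"
  by (simp add: matpow_deriv_def)

context gaussian_family
begin

lemma gmat_matpow:
  assumes "gmat v A A' J"
  shows "gmat v (\<lambda>t \<omega>. matpow (A t \<omega>) m) (\<lambda>t \<omega>. matpow_deriv (A t \<omega>) (A' t \<omega>) m)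
    (\<lambda>t \<omega>. matpow_deriv (A t \<omega>) (J t \<omega>) m)"
proof (induction m)
  case 0
  then show ?case by (simp add: matpow_deriv_def gmat_const)
next
  case (Suc m)
  then show ?case using gmat_mult[OF assms Suc] by (simp add: matpow_deriv_Suc)
qed

lemma expectation_trace_by_parts:
  assumes "finite S" and A: "\<And>k. k \<in> S \<Longrightarrow> gmat (v k) A (A' k) (J k)"
  shows "(LINT \<omega>|P. trace ((\<Sum>k\<in>S. lin (v k t) \<omega> *\<^sub>R H k) ** A t \<omega>)) =
    (\<Sum>k\<in>S. LINT \<omega>|P. trace (H k ** J k t \<omega>))"
proof -
  have tr: "gpoly (v k) (\<lambda>t \<omega>. trace (H k ** A t \<omega>)) (\<lambda>t \<omega>. trace (H k ** A' k t \<omega>)) (\<lambda>t \<omega>. trace (H k ** J k t \<omega>))"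
    if "k \<in> S" for k
    using gpoly_trace[OF gmat_mult[OF gmat_const A[OF that]], of "H k"] by simp
  have "(LINT \<omega>|P. trace ((\<Sum>k\<in>S. lin (v k t) \<omega> *\<^sub>R H k) ** A t \<omega>)) =
      (LINT \<omega>|P. (\<Sum>k\<in>S. of_real (lin (v k t) \<omega>) * trace (H k ** A t \<omega>)))"
    by (simp add: matrix_mult_sum_left trace_sum matrix_mult_scaleR_left trace_scaleR)
  also have "\<dots> = (\<Sum>k\<in>S. LINT \<omega>|P. of_real (lin (v k t) \<omega>) * trace (H k ** A t \<omega>))"
    by (intro Bochner_Integration.integral_sum integrable_gpoly(4)[OF tr])
  also have "\<dots> = (\<Sum>k\<in>S. LINT \<omega>|P. trace (H k ** J k t \<omega>))"
    by (intro sum.cong refl expectation_lin_mult_gpoly[OF tr])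
  finally show ?thesis .
qed

lemma integrable_trace_by_parts:
  assumes A: "\<And>k. k \<in> S \<Longrightarrow> gmat (v k) A (A' k) (J k)"
  shows "integrable P (\<lambda>\<omega>. trace ((\<Sum>k\<in>S. lin (v k t) \<omega> *\<^sub>R H k) ** A t \<omega>))"
proof -
  have "integrable P (\<lambda>\<omega>. \<Sum>k\<in>S. of_real (lin (v k t) \<omega>) * trace (H k ** A t \<omega>))"
    by (intro Bochner_Integration.integrable_sum
        integrable_gpoly(4)[OF gpoly_trace[OF gmat_mult[OF gmat_const A]]])
  then show ?thesis
    by (simp add: matrix_mult_sum_left trace_sum matrix_mult_scaleR_left trace_scaleR)
qed

text \<open>Hides the derivatives where only integrability matters; the zero direction is a
  canonical choice.\<close>

definition rmat :: "(real \<Rightarrow> 'a \<Rightarrow> complex^'d^'d) \<Rightarrow> bool" where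
  "rmat A \<longleftrightarrow> (\<exists>A' J. gmat (\<lambda>_ _. 0) A A' J)"

lemma rmat_const: "rmat (\<lambda>_ _. A)"
  unfolding rmat_def using gmat_const by blast

lemma rmat_mult: "rmat A \<Longrightarrow> rmat B \<Longrightarrow> rmat (\<lambda>t \<omega>. A t \<omega> ** B t \<omega>)"
  unfolding rmat_def using gmat_mult by blast

lemma rmat_matpow: "rmat A \<Longrightarrow> rmat (\<lambda>t \<omega>. matpow (A t \<omega>) m)"
  unfolding rmat_def using gmat_matpow by blast

lemma integrable_trace_rmat: "rmat A \<Longrightarrow> integrable P (\<lambda>\<omega>. trace (A t \<omega>))"
  unfolding rmat_def using integrable_gpoly(1)[OF gpoly_trace] by blast

lemma integrable_nth_rmat: "rmat A \<Longrightarrow> integrable P (\<lambda>\<omega>. A t \<omega> $ i $ j)"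
  unfolding rmat_def gmat_def using integrable_gpoly(1) by blast

end

section \<open>Two independent copies and their rotation\<close>

declare One_nat_def [simp del]

lemma (in pair_sigma_finite) integrable_integral_product:
  fixes f :: "'a \<Rightarrow> 'c::{real_normed_field, banach, second_countable_topology}"
  assumes f: "integrable M1 f" and g: "integrable M2 g"
  shows "integrable (M1 \<Otimes>\<^sub>M M2) (\<lambda>\<omega>. f (fst \<omega>) * g (snd \<omega>))" (is ?int)
    and "(LINT \<omega>|(M1 \<Otimes>\<^sub>M M2). f (fst \<omega>) * g (snd \<omega>)) = (LINT x|M1. f x) * (LINT y|M2. g y)" (is ?eq)
proof -
  note [measurable] = borel_measurable_integrable[OF f] borel_measurable_integrable[OF g]
  show ?int
    using f g by (intro Fubini_integrable) (simp_all add: norm_mult)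
  from integral_fst'[OF this] show ?eq by simp
qed

lemma integrable_matrix:
  fixes A :: "'a \<Rightarrow> complex^'d^'d"
  assumes "\<And>i j. integrable M (\<lambda>\<omega>. A \<omega> $ i $ j)"
  shows "integrable M A"
proof -
  define E where "E i j c = (\<chi> a b. if a = i \<and> b = j then c else 0 :: complex^'d^'d)" for i j :: 'd and c :: complex
  have bl: "bounded_linear (E i j)" for i j
    unfolding linear_conv_bounded_linear[symmetric]
    by (rule linearI) (simp_all add: E_def vec_eq_iff)
  have "integrable M (\<lambda>\<omega>. \<Sum>i\<in>UNIV. \<Sum>j\<in>UNIV. E i j (A \<omega> $ i $ j))"
    by (intro Bochner_Integration.integrable_sum integrable_bounded_linear[OF bl] assms)
  moreover have "(\<Sum>i\<in>UNIV. \<Sum>j\<in>UNIV. E i j (B $ i $ j)) = B" for B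
  proof -
    have "(\<Sum>i\<in>UNIV. \<Sum>j\<in>UNIV. if a = i \<and> b = j then B $ i $ j else 0) = B $ a $ b" for a b
    proof -
      have "(\<Sum>i\<in>UNIV. \<Sum>j\<in>UNIV. if a = i \<and> b = j then B $ i $ j else 0) =
          (\<Sum>i\<in>UNIV. if a = i then B $ i $ b else 0)"
        by (intro sum.cong refl) simp
      then show ?thesis by simp
    qed
    then show ?thesis by (simp add: vec_eq_iff E_def)
  qed
  ultimately show ?thesis by simp
qed

lemma integral_matrix_mult_left:
  fixes A :: "'a \<Rightarrow> complex^'d^'d" and B :: "complex^'d^'d"
  assumes "integrable M A"
  shows "(LINT \<omega>|M. B ** A \<omega>) = B ** (LINT \<omega>|M. A \<omega>)"
proof (rule integral_bounded_linear[OF _ assms])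
  show "bounded_linear (\<lambda>A :: complex^'d^'d. B ** A)"
    unfolding linear_conv_bounded_linear[symmetric]
    by (rule linearI) (simp_all add: matrix_add_ldistrib matrix_mult_scaleR_right)
qed

lemma integral_matrix_nth:
  fixes A :: "'a \<Rightarrow> complex^'d^'d"
  assumes "integrable M A"
  shows "(LINT \<omega>|M. A \<omega>) $ i $ j = (LINT \<omega>|M. A \<omega> $ i $ j)"
  by (rule integral_bounded_linear[OF _ assms, symmetric])
     (intro bounded_linear_compose[OF bounded_linear_vec_nth bounded_linear_vec_nth])

text \<open>Strong isotropy is kept apart as a hypothesis of the few lemmas that use it; rotation
  invariance and the derivative formula hold for every Gaussian sum.\<close>

locale gaussian_sum = prob_space M for M :: "'a measure" +
  fixes n :: nat and H :: "nat \<Rightarrow> complex^'d^'d" and \<gamma> :: "nat \<Rightarrow> 'a \<Rightarrow> real"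
  assumes hermitian_H: "\<And>i. i \<in> {1..n} \<Longrightarrow> hermitian (H i)"
    and indep: "indep_vars (\<lambda>_. borel) \<gamma> {1..n}"
    and normal: "\<And>i. i \<in> {1..n} \<Longrightarrow> distributed M lborel (\<gamma> i) std_normal_density"
begin

lemma
  shows integrable_normal_monomial: "integrable M (\<lambda>\<omega>. \<Prod>k\<in>{1..n}. \<gamma> k \<omega> ^ m k)"
    and expectation_normal_monomial:
      "(LINT \<omega>|M. (\<Prod>k\<in>{1..n}. \<gamma> k \<omega> ^ m k)) = (\<Prod>k\<in>{1..n}. gauss_moment (m k))"
proof -
  have ind: "indep_vars (\<lambda>_. borel) (\<lambda>k \<omega>. \<gamma> k \<omega> ^ m k) {1..n}"
    by (rule indep_vars_compose2[OF indep]) measurable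
  have int: "integrable M (\<lambda>\<omega>. \<gamma> k \<omega> ^ m k)" if "k \<in> {1..n}" for k
    using distributed_integrable[OF normal[OF that], of "\<lambda>x. x ^ m k"] integrable_std_normal_moment
    by simp
  have "(LINT \<omega>|M. \<gamma> k \<omega> ^ m k) = gauss_moment (m k)" if "k \<in> {1..n}" for k
    using distributed_integral[OF normal[OF that], of "\<lambda>x. x ^ m k"] by (simp add: gauss_moment_def)
  then show "integrable M (\<lambda>\<omega>. \<Prod>k\<in>{1..n}. \<gamma> k \<omega> ^ m k)"
      "(LINT \<omega>|M. (\<Prod>k\<in>{1..n}. \<gamma> k \<omega> ^ m k)) = (\<Prod>k\<in>{1..n}. gauss_moment (m k))"
    using indep_vars_integrable[OF _ ind int] indep_vars_lebesgue_integral[OF _ ind int] by simp_all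
qed

sublocale base: gaussian_family M "{1..n}" \<gamma>
  by unfold_locales (simp_all add: integrable_normal_monomial expectation_normal_monomial)

abbreviation P :: "('a \<times> 'a) measure" where "P \<equiv> M \<Otimes>\<^sub>M M"

sublocale MM: pair_prob_space M M ..

abbreviation two_copies :: "nat + nat \<Rightarrow> 'a \<times> 'a \<Rightarrow> real" where
  "two_copies \<equiv> case_sum (\<lambda>k \<omega>. \<gamma> k (fst \<omega>)) (\<lambda>k \<omega>. \<gamma> k (snd \<omega>))"

text \<open>On the product space the two coordinates carry independent copies. Fubini factors the
  joint moments, so all \<open>2 * n\<close> variables together form a Gaussian family.\<close>

sublocale pair: gaussian_family P "{1..n} <+> {1..n}" two_copies
proof
  fix m :: "nat + nat \<Rightarrow> nat"
  have eq: "(\<Prod>k\<in>{1..n} <+> {1..n}. two_copies k \<omega> ^ m k) =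
      (\<Prod>k\<in>{1..n}. \<gamma> k (fst \<omega>) ^ m (Inl k)) * (\<Prod>k\<in>{1..n}. \<gamma> k (snd \<omega>) ^ m (Inr k))" for \<omega>
    by (subst prod.Plus) simp_all
  show "integrable P (\<lambda>\<omega>. \<Prod>k\<in>{1..n} <+> {1..n}. two_copies k \<omega> ^ m k)"
    unfolding eq by (intro MM.integrable_integral_product(1) integrable_normal_monomial)
  show "(LINT \<omega>|P. (\<Prod>k\<in>{1..n} <+> {1..n}. two_copies k \<omega> ^ m k)) = (\<Prod>k\<in>{1..n} <+> {1..n}. gauss_moment (m k))"
    unfolding eq
    by (subst MM.integrable_integral_product(2))
       (simp_all add: integrable_normal_monomial expectation_normal_monomial prod.Plus o_def)
qed simp

definition X :: "'a \<Rightarrow> complex^'d^'d" where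
  "X = gaussian_matrix n H \<gamma>"

definition Z :: "real \<Rightarrow> 'a \<times> 'a \<Rightarrow> complex^'d^'d" where
  "Z t \<omega> = cos t *\<^sub>R X (fst \<omega>) + sin t *\<^sub>R X (snd \<omega>)"

definition Z' :: "real \<Rightarrow> 'a \<times> 'a \<Rightarrow> complex^'d^'d" where
  "Z' t \<omega> = - sin t *\<^sub>R X (fst \<omega>) + cos t *\<^sub>R X (snd \<omega>)"

lemma hermitian_X: "hermitian (X \<omega>)"
proof -
  have "cnj (H k $ j $ i) = H k $ i $ j" if "k \<in> {1..n}" for k i j
    using hermitian_H[OF that] by (metis hermitian_def conj_transpose_nth)
  then show ?thesis
    by (simp add: X_def gaussian_matrix_def hermitian_def vec_eq_iff)
qed

lemma hermitian_Z: "hermitian (Z t \<omega>)"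
  using hermitian_X[of "fst \<omega>"] hermitian_X[of "snd \<omega>"]
  by (simp add: Z_def hermitian_def vec_eq_iff)

lemma gmat_X_base:
  "base.gmat v (\<lambda>_. X) (\<lambda>_ _. 0) (\<lambda>t _. \<Sum>k=1..n. v t k *\<^sub>R H k)"
proof -
  have "base.gmat v (\<lambda>_ \<omega>. \<gamma> k \<omega> *\<^sub>R H k) (\<lambda>_ _. 0 *\<^sub>R H k) (\<lambda>t _. v t k *\<^sub>R H k)" if "k \<in> {1..n}" for k
    using base.gpoly_var[OF that, of v] by (intro base.gmat_scaleR) simp
  from base.gmat_sum[OF this, of "{1..n}"] show ?thesis
    by (simp add: X_def gaussian_matrix_def[abs_def])
qed

lemma gmat_Z:
  "pair.gmat v Z Z' (\<lambda>t _. \<Sum>k=1..n. (cos t * v t (Inl k) + sin t * v t (Inr k)) *\<^sub>R H k)"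
proof -
  have "pair.gmat v (\<lambda>t \<omega>. (cos t * \<gamma> k (fst \<omega>) + sin t * \<gamma> k (snd \<omega>)) *\<^sub>R H k)
      (\<lambda>t \<omega>. (- sin t * \<gamma> k (fst \<omega>) + cos t * \<gamma> k (snd \<omega>)) *\<^sub>R H k)
      (\<lambda>t _. (cos t * v t (Inl k) + sin t * v t (Inr k)) *\<^sub>R H k)" if "k \<in> {1..n}" for k
  proof (rule pair.gmat_scaleR)
    have k: "Inl k \<in> {1..n} <+> {1..n}" "Inr k \<in> {1..n} <+> {1..n}" using that by auto
    have d: "((\<lambda>t. complex_of_real (cos t)) has_vector_derivative of_real (- sin t)) (at t)"
      "((\<lambda>t. complex_of_real (sin t)) has_vector_derivative of_real (cos t)) (at t)" for t
      by (auto intro!: has_vector_derivative_of_real has_real_derivative_iff_has_vector_derivative[THEN iffD1]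
          derivative_eq_intros)
    show "pair.gpoly v (\<lambda>t \<omega>. of_real (cos t * \<gamma> k (fst \<omega>) + sin t * \<gamma> k (snd \<omega>)))
        (\<lambda>t \<omega>. of_real (- sin t * \<gamma> k (fst \<omega>) + cos t * \<gamma> k (snd \<omega>)))
        (\<lambda>t \<omega>. of_real (cos t * v t (Inl k) + sin t * v t (Inr k)))"
      by (rule pair.gpoly_cong[OF pair.gpoly_add[OF
            pair.gpoly_mult[OF pair.gpoly_coeff[OF d(1)] pair.gpoly_var[OF k(1)]]
            pair.gpoly_mult[OF pair.gpoly_coeff[OF d(2)] pair.gpoly_var[OF k(2)]]]]) simp_all
  qed
  then have "pair.gmat v (\<lambda>t \<omega>. \<Sum>k=1..n. (cos t * \<gamma> k (fst \<omega>) + sin t * \<gamma> k (snd \<omega>)) *\<^sub>R H k)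
      (\<lambda>t \<omega>. \<Sum>k=1..n. (- sin t * \<gamma> k (fst \<omega>) + cos t * \<gamma> k (snd \<omega>)) *\<^sub>R H k)
      (\<lambda>t _. \<Sum>k=1..n. (cos t * v t (Inl k) + sin t * v t (Inr k)) *\<^sub>R H k)"
    by (rule pair.gmat_sum)
  moreover have "Z = (\<lambda>t \<omega>. \<Sum>k=1..n. (cos t * \<gamma> k (fst \<omega>) + sin t * \<gamma> k (snd \<omega>)) *\<^sub>R H k)"
      "Z' = (\<lambda>t \<omega>. \<Sum>k=1..n. (- sin t * \<gamma> k (fst \<omega>) + cos t * \<gamma> k (snd \<omega>)) *\<^sub>R H k)"
    by (simp_all add: fun_eq_iff X_def Z_def Z'_def gaussian_matrix_def scaleR_sum_right
        sum.distrib scaleR_add_left scaleR_diff_left sum_negf sum_subtractf)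
  ultimately show ?thesis by simp
qed

lemma gmat_X: "pair.gmat v (\<lambda>_ \<omega>. X (fst \<omega>)) (\<lambda>_ _. 0) (\<lambda>t _. \<Sum>k=1..n. v t (Inl k) *\<^sub>R H k)"
proof -
  have "pair.gmat v (\<lambda>_ \<omega>. \<gamma> k (fst \<omega>) *\<^sub>R H k) (\<lambda>_ _. 0 *\<^sub>R H k) (\<lambda>t _. v t (Inl k) *\<^sub>R H k)" if "k \<in> {1..n}" for k
    using pair.gpoly_var[OF InlI[OF that], of v] by (intro pair.gmat_scaleR) simp
  from pair.gmat_sum[OF this, of "{1..n}"] show ?thesis
    by (simp add: X_def gaussian_matrix_def[abs_def])
qed

text \<open>The tangent direction of the rotation \<open>t \<mapsto> Z t\<close>; \<open>Z t\<close> is constant along it.\<close>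

definition rot :: "nat \<Rightarrow> real \<Rightarrow> nat + nat \<Rightarrow> real" where
  "rot k t = case_sum (\<lambda>i. if i = k then - sin t else 0) (\<lambda>i. if i = k then cos t else 0)"

lemma gmat_Z_rot: "k \<in> {1..n} \<Longrightarrow> pair.gmat (rot k) Z Z' (\<lambda>_ _. 0)"
  using gmat_Z[of "rot k"] by (simp add: rot_def if_distrib mult.commute cong: if_cong)

lemma gmat_X_rot: "k \<in> {1..n} \<Longrightarrow> pair.gmat (rot k) (\<lambda>_ \<omega>. X (fst \<omega>)) (\<lambda>_ _. 0) (\<lambda>t _. - sin t *\<^sub>R H k)"
  using gmat_X[of "rot k"] by (simp add: rot_def if_distribR if_distrib cong: if_cong)

text \<open>The velocity of the rotation is the Gaussian sum along the directions
  \<open>rot k\<close>. A factor \<open>Z'\<close> can therefore be integrated by parts in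
  directions that leave \<open>Z t\<close> unchanged.\<close>

lemma Z'_eq: "Z' t \<omega> = (\<Sum>k=1..n. pair.lin (rot k t) \<omega> *\<^sub>R H k)"
proof -
  have "pair.lin (rot k t) \<omega> = - sin t * \<gamma> k (fst \<omega>) + cos t * \<gamma> k (snd \<omega>)" if "k \<in> {1..n}" for k
    using that unfolding pair.lin_def
    by (subst sum.Plus) (simp_all add: rot_def if_distribR if_distrib cong: if_cong)
  then show ?thesis
    by (simp add: Z'_def X_def gaussian_matrix_def scaleR_sum_right scaleR_add_left scaleR_diff_left
        sum.distrib sum_negf sum_subtractf)
qed

lemma expectation_Z'_by_parts:
  assumes "\<And>k. k \<in> {1..n} \<Longrightarrow> pair.gmat (rot k) A (A' k) (J k)"
  shows "(LINT \<omega>|P. trace (Z' t \<omega> ** A t \<omega>)) = (\<Sum>k=1..n. LINT \<omega>|P. trace (H k ** J k t \<omega>))"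
  unfolding Z'_eq by (rule pair.expectation_trace_by_parts[OF _ assms]) simp

end

lemma matpow_deriv_scaleR: "matpow_deriv A (c *\<^sub>R B) m = c *\<^sub>R matpow_deriv A B m"
  by (simp add: matpow_deriv_def matrix_mult_scaleR_left matrix_mult_scaleR_right scaleR_sum_right)

lemma matpow_scaleR: "matpow (c *\<^sub>R A) m = (c ^ m) *\<^sub>R matpow A m"
  by (induction m) (simp_all add: matrix_mult_scaleR_left matrix_mult_scaleR_right mult.commute)

lemma trace_matpow_hermitian:
  "hermitian A \<Longrightarrow> trace (matpow A m) = of_real (Re (trace (matpow A m)))"
  by (erule spectral_theorem) (simp add: matpow_spectral_mat trace_spectral_mat)

context gaussian_sum
begin

lemma rmat_Z: "pair.rmat Z"
  unfolding pair.rmat_def using gmat_Z by blast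

lemma rmat_X: "pair.rmat (\<lambda>_ \<omega>. X (fst \<omega>))"
  unfolding pair.rmat_def using gmat_X by blast

lemma rmat_X_base: "base.rmat (\<lambda>_. X)"
  unfolding base.rmat_def using gmat_X_base by blast

lemmas rmat_intros = pair.rmat_mult pair.rmat_matpow pair.rmat_const rmat_Z rmat_X

text \<open>Cyclicity moves \<open>Z'\<close> to the front of each word. Integration by parts along
  \<open>rot k\<close> then passes over the powers of \<open>Z t\<close> and hits only
  \<open>B\<close>.\<close>

lemma expectation_trace_matpow_deriv:
  assumes B: "\<And>k. k \<in> {1..n} \<Longrightarrow> pair.gmat (rot k) B (B' k) (J k)"
  shows "(LINT \<omega>|P. trace (B t \<omega> ** matpow_deriv (Z t \<omega>) (Z' t \<omega>) s)) =
    (\<Sum>r<s. \<Sum>k=1..n. LINT \<omega>|P. trace (H k ** matpow (Z t \<omega>) (s - 1 - r) ** J k t \<omega> ** matpow (Z t \<omega>) r))"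
proof -
  let ?A = "\<lambda>r t \<omega>. matpow (Z t \<omega>) (s - 1 - r) ** B t \<omega> ** matpow (Z t \<omega>) r"
  let ?A' = "\<lambda>k r t \<omega>. (matpow_deriv (Z t \<omega>) (Z' t \<omega>) (s - 1 - r) ** B t \<omega> +
      matpow (Z t \<omega>) (s - 1 - r) ** B' k t \<omega>) ** matpow (Z t \<omega>) r +
      matpow (Z t \<omega>) (s - 1 - r) ** B t \<omega> ** matpow_deriv (Z t \<omega>) (Z' t \<omega>) r"
  have A': "pair.gmat (rot k) (?A r) (?A' k r) (\<lambda>t \<omega>. matpow (Z t \<omega>) (s - 1 - r) ** J k t \<omega> ** matpow (Z t \<omega>) r)"
    if "k \<in> {1..n}" for k r
    using pair.gmat_mult[OF pair.gmat_mult[OF pair.gmat_matpow[OF gmat_Z_rot[OF that], of "s - 1 - r"] B[OF that]]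
        pair.gmat_matpow[OF gmat_Z_rot[OF that], of r]]
    by simp
  have int: "integrable P (\<lambda>\<omega>. trace (Z' t \<omega> ** ?A r t \<omega>))" for r
    unfolding Z'_eq by (rule pair.integrable_trace_by_parts[where A = "?A r"], rule A')
  have "trace (B t \<omega> ** matpow_deriv (Z t \<omega>) (Z' t \<omega>) s) = (\<Sum>r<s. trace (Z' t \<omega> ** ?A r t \<omega>))" for \<omega>
  proof -
    have "trace (B t \<omega> ** (matpow (Z t \<omega>) r ** Z' t \<omega> ** matpow (Z t \<omega>) (s - 1 - r))) = trace (Z' t \<omega> ** ?A r t \<omega>)" for r
      using trace_mul_sym[of "B t \<omega> ** matpow (Z t \<omega>) r" "Z' t \<omega> ** matpow (Z t \<omega>) (s - 1 - r)"]
      by (simp add: matrix_mul_assoc)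
    then show ?thesis by (simp add: matpow_deriv_def matrix_mult_sum_right trace_sum)
  qed
  then have "(LINT \<omega>|P. trace (B t \<omega> ** matpow_deriv (Z t \<omega>) (Z' t \<omega>) s)) =
      (LINT \<omega>|P. (\<Sum>r<s. trace (Z' t \<omega> ** ?A r t \<omega>)))" by simp
  also have "\<dots> = (\<Sum>r<s. LINT \<omega>|P. trace (Z' t \<omega> ** ?A r t \<omega>))"
    by (intro Bochner_Integration.integral_sum int)
  also have "\<dots> = (\<Sum>r<s. \<Sum>k=1..n. LINT \<omega>|P. trace (H k ** (matpow (Z t \<omega>) (s - 1 - r) ** J k t \<omega> ** matpow (Z t \<omega>) r)))"
    
    by (intro sum.cong refl expectation_Z'_by_parts) (rule A')
  finally show ?thesis by (simp add: matrix_mul_assoc)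
qed

text \<open>Rotation invariance of the trace moments: with \<open>B = mat 1\<close> there is nothing
  to differentiate, so the derivative in \<open>t\<close> vanishes.\<close>

lemma expectation_trace_Z:
  "(LINT \<omega>|P. trace (matpow (Z t \<omega>) N)) = (LINT \<omega>|P. trace (matpow (X (fst \<omega>)) N))"
proof -
  have "((\<lambda>t. LINT \<omega>|P. trace (matpow (Z t \<omega>) N)) has_vector_derivative 0) (at t within UNIV)" for t
  proof -
    have "(LINT \<omega>|P. trace (mat 1 ** matpow_deriv (Z t \<omega>) (Z' t \<omega>) N)) = 0"
      by (subst expectation_trace_matpow_deriv[OF pair.gmat_const]) (simp add: trace_def)
    with pair.expectation_gpoly_deriv[OF pair.gpoly_trace[OF pair.gmat_matpow[OF gmat_Z, where m = N]], where t = t]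
    show ?thesis by simp
  qed
  then obtain c where c: "\<And>t. (LINT \<omega>|P. trace (matpow (Z t \<omega>) N)) = c"
    using has_vector_derivative_zero_constant[of UNIV "\<lambda>t. LINT \<omega>|P. trace (matpow (Z t \<omega>) N)"]
    by auto
  from c[of t] c[of 0] show ?thesis by (simp add: Z_def)
qed

lemma expectation_trace_fst:
  "(LINT \<omega>|P. trace (matpow (X (fst \<omega>)) N)) = (LINT \<omega>|M. trace (matpow (X \<omega>) N))"
  using MM.integrable_integral_product(2)[OF base.integrable_trace_rmat[OF base.rmat_matpow[OF rmat_X_base]],
      of "\<lambda>_. 1" N] prob_space
  by simp

text \<open>\<open>moment (2 * k)\<close> is the quantity \<open>a\<^sub>k\<close> of the overview.
  Odd orders are included because the sums in \<open>psi\<close> run over all splittings of the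
  degree.\<close>

definition moment :: "nat \<Rightarrow> real" where
  "moment N = Re (LINT \<omega>|M. trace (matpow (X \<omega>) N)) / real CARD('d)"

lemma expectation_trace_eq_moment: "(LINT \<omega>|M. trace (matpow (X \<omega>) N)) = of_real (real CARD('d) * moment N)"
proof -
  have "(LINT \<omega>|M. trace (matpow (X \<omega>) N)) = (LINT \<omega>|M. of_real (Re (trace (matpow (X \<omega>) N))))"
    using trace_matpow_hermitian[OF hermitian_X] by simp
  also have "\<dots> = of_real (LINT \<omega>|M. Re (trace (matpow (X \<omega>) N)))"
    by (rule integral_complex_of_real)
  finally show ?thesis by (simp add: moment_def)
qed

lemma moment_0: "moment 0 = 1"
  using prob_space by (simp add: moment_def trace_def mat_def)

text \<open>The half turn sends \<open>X\<close> to \<open>-X\<close>, while the trace moments are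
  rotation invariant.\<close>

lemma moment_odd:
  assumes "odd N"
  shows "moment N = 0"
proof -
  have "(LINT \<omega>|P. trace (matpow (Z pi \<omega>) N)) = - (LINT \<omega>|P. trace (matpow (X (fst \<omega>)) N))"
  proof -
    have "matpow (- A) N = - matpow A N" for A :: "complex^'d^'d"
      using assms matpow_scaleR[of "-1" A N] by simp
    then have "trace (matpow (Z pi \<omega>) N) = - trace (matpow (X (fst \<omega>)) N)" for \<omega>
      by (simp add: Z_def trace_def sum_negf)
    then show ?thesis by simp
  qed
  then have "(LINT \<omega>|M. trace (matpow (X \<omega>) N)) = 0"
    by (simp add: expectation_trace_Z expectation_trace_fst)
  then show ?thesis by (simp add: moment_def)
qed

lemma moment_even_nonneg: "0 \<le> moment (2 * m)"
proof -
  have "0 \<le> Re (trace (matpow (X \<omega>) (2 * m)))" for \<omega>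
    by (rule spectral_theorem[OF hermitian_X[of \<omega>]])
       (simp add: matpow_spectral_mat trace_spectral_mat sum_nonneg)
  then have "0 \<le> (LINT \<omega>|M. Re (trace (matpow (X \<omega>) (2 * m))))" by simp
  also have "\<dots> = Re (LINT \<omega>|M. trace (matpow (X \<omega>) (2 * m)))"
    by (intro integral_Re base.integrable_trace_rmat base.rmat_matpow rmat_X_base)
  finally show ?thesis by (simp add: moment_def)
qed

section \<open>Interpolation between equal and independent factors\<close>

definition psi :: "nat \<Rightarrow> real \<Rightarrow> complex" where
  "psi m t = (\<Sum>q\<le>m. \<Sum>k=1..n. LINT \<omega>|P. trace (H k ** matpow (X (fst \<omega>)) q ** H k ** matpow (Z t \<omega>) (m - q)))"

text \<open>The derivative of \<open>psi m\<close> without its factor \<open>- sin t\<close>. In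
  each word the powers come in the cyclic order Z, X, X, Z and the coefficients alternate, the
  pattern of \<open>quartic\<close>.\<close>

definition psi' :: "nat \<Rightarrow> real \<Rightarrow> complex" where
  "psi' m t = (\<Sum>q\<le>m. \<Sum>r<m - q. \<Sum>r'<q. LINT \<omega>|P. quartic_trace n H (matpow (Z t \<omega>) (m - q - 1 - r))
      (matpow (X (fst \<omega>)) r') (matpow (X (fst \<omega>)) (q - 1 - r')) (matpow (Z t \<omega>) r))"

lemma psi_0: "psi m 0 = of_real (real CARD('d) * moment (m + 2))"
proof -
  \<comment> \<open>Coordinate directions of a single copy: the functional dual to
    \<open>?v k\<close> is \<open>\<gamma> k\<close> itself.\<close>
  let ?v = "\<lambda>k t i. if i = k then 1 else 0 :: real"
  have v: "base.gmat (?v k) (\<lambda>_ \<omega>. matpow (X \<omega>) (Suc m)) (\<lambda>_ _. 0)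
      (\<lambda>_ \<omega>. \<Sum>q\<le>m. matpow (X \<omega>) q ** H k ** matpow (X \<omega>) (m - q))" if "k \<in> {1..n}" for k
  proof -
    have "base.gmat (?v k) (\<lambda>_. X) (\<lambda>_ _. 0) (\<lambda>_ _. H k)"
      using gmat_X_base[of "?v k"] that by (simp add: if_distribR if_distrib cong: if_cong)
    from base.gmat_matpow[OF this, of "Suc m"] show ?thesis
      by (simp add: matpow_deriv_def[of _ _ "Suc m"] lessThan_Suc_atMost matpow_deriv_0[of _ "Suc m"] del: matpow.simps)
  qed
  have "base.lin (?v k t) \<omega> = \<gamma> k \<omega>" if "k \<in> {1..n}" for k t \<omega>
    using that by (simp add: base.lin_def if_distribR if_distrib cong: if_cong)
  then have X_eq: "X \<omega> = (\<Sum>k=1..n. base.lin (?v k 0) \<omega> *\<^sub>R H k)" for \<omega>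
    by (simp add: X_def gaussian_matrix_def)
  have "(LINT \<omega>|M. trace (matpow (X \<omega>) (m + 2))) =
      (LINT \<omega>|M. trace ((\<Sum>k=1..n. base.lin (?v k 0) \<omega> *\<^sub>R H k) ** matpow (X \<omega>) (Suc m)))"
    unfolding X_eq[symmetric] by simp
  also have "\<dots> = (\<Sum>k=1..n. LINT \<omega>|M. trace (H k ** (\<Sum>q\<le>m. matpow (X \<omega>) q ** H k ** matpow (X \<omega>) (m - q))))"
    by (rule base.expectation_trace_by_parts[OF _ v]) simp_all
  also have "\<dots> = (\<Sum>k=1..n. LINT \<omega>|M. (\<Sum>q\<le>m. trace (H k ** matpow (X \<omega>) q ** H k ** matpow (X \<omega>) (m - q))))"
    by (simp add: matrix_mult_sum_right trace_sum matrix_mul_assoc)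
  also have "\<dots> = (\<Sum>k=1..n. \<Sum>q\<le>m. LINT \<omega>|M. trace (H k ** matpow (X \<omega>) q ** H k ** matpow (X \<omega>) (m - q)))"
    by (intro sum.cong refl Bochner_Integration.integral_sum base.integrable_trace_rmat base.rmat_mult
        base.rmat_const base.rmat_matpow rmat_X_base)
  also have "\<dots> = (\<Sum>k=1..n. \<Sum>q\<le>m. LINT \<omega>|P. trace (H k ** matpow (X (fst \<omega>)) q ** H k ** matpow (Z 0 \<omega>) (m - q)))"
  proof (intro sum.cong refl)
    fix k q
    have "integrable M (\<lambda>\<omega>. trace (H k ** matpow (X \<omega>) q ** H k ** matpow (X \<omega>) (m - q)))"
      by (intro base.integrable_trace_rmat base.rmat_mult base.rmat_const base.rmat_matpow rmat_X_base)
    from MM.integrable_integral_product(2)[OF this, of "\<lambda>_. 1"] prob_space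
    show "(LINT \<omega>|M. trace (H k ** matpow (X \<omega>) q ** H k ** matpow (X \<omega>) (m - q))) =
        (LINT \<omega>|P. trace (H k ** matpow (X (fst \<omega>)) q ** H k ** matpow (Z 0 \<omega>) (m - q)))"
      by (simp add: Z_def)
  qed
  also have "\<dots> = psi m 0" unfolding psi_def by (rule sum.swap)
  finally show ?thesis by (simp only: expectation_trace_eq_moment)
qed

text \<open>Differentiating in \<open>t\<close> turns one factor \<open>Z t\<close> into
  \<open>Z'\<close>, which is then integrated by parts along the rotation. Only the power of
  \<open>X\<close> reacts, through the derivative \<open>- sin t *\<^sub>R H j\<close> of
  \<open>X\<close>; hence the common factor.\<close>

lemma psi_deriv: "(psi m has_vector_derivative - sin t *\<^sub>R psi' m t) (at t)"
proof -
  let ?B = "\<lambda>k q t \<omega>. H k ** matpow (X (fst \<omega>)) q ** H k"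
  have gB: "pair.gmat v (?B k q) (\<lambda>_ _. 0)
      (\<lambda>t \<omega>. H k ** matpow_deriv (X (fst \<omega>)) (\<Sum>j=1..n. v t (Inl j) *\<^sub>R H j) q ** H k)" for v k q
    using pair.gmat_mult[OF pair.gmat_mult[OF pair.gmat_const[of v "H k"] pair.gmat_matpow[OF gmat_X, of v q]]
        pair.gmat_const[of v "H k"]] by simp
  have gB_rot: "pair.gmat (rot j) (?B k q) (\<lambda>_ _. 0)
      (\<lambda>t \<omega>. H k ** matpow_deriv (X (fst \<omega>)) (- sin t *\<^sub>R H j) q ** H k)" if "j \<in> {1..n}" for j k q
    using pair.gmat_mult[OF pair.gmat_mult[OF pair.gmat_const[of "rot j" "H k"]
        pair.gmat_matpow[OF gmat_X_rot[OF that], of q]] pair.gmat_const[of "rot j" "H k"]] by simp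
  have "((\<lambda>t. LINT \<omega>|P. trace (?B k q t \<omega> ** matpow (Z t \<omega>) s)) has_vector_derivative
      (LINT \<omega>|P. trace (?B k q t \<omega> ** matpow_deriv (Z t \<omega>) (Z' t \<omega>) s))) (at t)" for k q s
    using pair.expectation_gpoly_deriv[OF pair.gpoly_trace[OF pair.gmat_mult[OF gB[of "\<lambda>_ _. 0"]
          pair.gmat_matpow[OF gmat_Z, of _ s]]], of k q t] by simp
  then have deriv: "(psi m has_vector_derivative
      (\<Sum>q\<le>m. \<Sum>k=1..n. LINT \<omega>|P. trace (?B k q t \<omega> ** matpow_deriv (Z t \<omega>) (Z' t \<omega>) (m - q)))) (at t)"
    unfolding psi_def[abs_def] by (intro has_vector_derivative_sum)
  let ?T = "\<lambda>q r r' k j \<omega>. trace (H j ** matpow (Z t \<omega>) (m - q - 1 - r) ** H k ** matpow (X (fst \<omega>)) r' **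
      H j ** matpow (X (fst \<omega>)) (q - 1 - r') ** H k ** matpow (Z t \<omega>) r)"
  have int: "integrable P (?T q r r' k j)" for q r r' k j
    by (intro pair.integrable_trace_rmat rmat_intros)
  have "(LINT \<omega>|P. trace (?B k q t \<omega> ** matpow_deriv (Z t \<omega>) (Z' t \<omega>) (m - q))) =
      - sin t *\<^sub>R (\<Sum>r<m - q. \<Sum>j=1..n. \<Sum>r'<q. LINT \<omega>|P. ?T q r r' k j \<omega>)" for k q
  proof -
    have "trace (H j ** matpow (Z t \<omega>) (m - q - 1 - r) ** (H k ** matpow_deriv (X (fst \<omega>)) (- sin t *\<^sub>R H j) q ** H k) **
        matpow (Z t \<omega>) r) = of_real (- sin t) * (\<Sum>r'<q. ?T q r r' k j \<omega>)" for j r \<omega>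
      unfolding matpow_deriv_scaleR
      by (simp only: matpow_deriv_def matrix_mult_scaleR_left matrix_mult_scaleR_right trace_scaleR
          matrix_mult_sum_left matrix_mult_sum_right trace_sum matrix_mul_assoc)
    then have "(LINT \<omega>|P. trace (?B k q t \<omega> ** matpow_deriv (Z t \<omega>) (Z' t \<omega>) (m - q))) =
        (\<Sum>r<m - q. \<Sum>j=1..n. LINT \<omega>|P. of_real (- sin t) * (\<Sum>r'<q. ?T q r r' k j \<omega>))"
      by (subst expectation_trace_matpow_deriv[OF gB_rot]) (simp_all only:)
    also have "\<dots> = (\<Sum>r<m - q. \<Sum>j=1..n. of_real (- sin t) * (\<Sum>r'<q. LINT \<omega>|P. ?T q r r' k j \<omega>))"
    proof (intro sum.cong refl)
      fix r j
      show "(LINT \<omega>|P. of_real (- sin t) * (\<Sum>r'<q. ?T q r r' k j \<omega>)) =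
          of_real (- sin t) * (\<Sum>r'<q. LINT \<omega>|P. ?T q r r' k j \<omega>)"
        unfolding integral_mult_right_zero by (subst Bochner_Integration.integral_sum) (simp_all only: int)
    qed
    finally show ?thesis by (simp add: sum_distrib_left scaleR_conv_of_real sum_negf)
  qed
  then have "(\<Sum>q\<le>m. \<Sum>k=1..n. LINT \<omega>|P. trace (?B k q t \<omega> ** matpow_deriv (Z t \<omega>) (Z' t \<omega>) (m - q))) =
      - sin t *\<^sub>R (\<Sum>q\<le>m. \<Sum>k=1..n. \<Sum>r<m - q. \<Sum>j=1..n. \<Sum>r'<q. LINT \<omega>|P. ?T q r r' k j \<omega>)"
    by (simp only: scaleR_sum_right)
  \<comment> \<open>Only the order of summation changes: the coefficient sums go innermost, where
    they form \<open>quartic_trace\<close>.\<close>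
  also have "(\<Sum>q\<le>m. \<Sum>k=1..n. \<Sum>r<m - q. \<Sum>j=1..n. \<Sum>r'<q. LINT \<omega>|P. ?T q r r' k j \<omega>) =
      (\<Sum>q\<le>m. \<Sum>r<m - q. \<Sum>r'<q. \<Sum>j=1..n. \<Sum>k=1..n. LINT \<omega>|P. ?T q r r' k j \<omega>)"
  proof (rule sum.cong[OF refl])
    fix q
    have "(\<Sum>k=1..n. \<Sum>r<m - q. \<Sum>j=1..n. \<Sum>r'<q. LINT \<omega>|P. ?T q r r' k j \<omega>) =
        (\<Sum>r<m - q. \<Sum>k=1..n. \<Sum>r'<q. \<Sum>j=1..n. LINT \<omega>|P. ?T q r r' k j \<omega>)"
      by (rule trans[OF sum.swap], rule sum.cong[OF refl], rule sum.cong[OF refl], rule sum.swap)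
    also have "\<dots> = (\<Sum>r<m - q. \<Sum>r'<q. \<Sum>k=1..n. \<Sum>j=1..n. LINT \<omega>|P. ?T q r r' k j \<omega>)"
      by (rule sum.cong[OF refl], rule sum.swap)
    also have "\<dots> = (\<Sum>r<m - q. \<Sum>r'<q. \<Sum>j=1..n. \<Sum>k=1..n. LINT \<omega>|P. ?T q r r' k j \<omega>)"
      by (rule sum.cong[OF refl], rule sum.cong[OF refl], rule sum.swap)
    finally show "(\<Sum>k=1..n. \<Sum>r<m - q. \<Sum>j=1..n. \<Sum>r'<q. LINT \<omega>|P. ?T q r r' k j \<omega>) = \<dots>" .
  qed
  also have "\<dots> = psi' m t"
  proof -
    have "(LINT \<omega>|P. (\<Sum>j=1..n. \<Sum>k=1..n. ?T q r r' k j \<omega>)) = (\<Sum>j=1..n. \<Sum>k=1..n. LINT \<omega>|P. ?T q r r' k j \<omega>)"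
      for q r r'
      by (subst Bochner_Integration.integral_sum, intro Bochner_Integration.integrable_sum int)
         (intro sum.cong refl Bochner_Integration.integral_sum int)
    then show ?thesis unfolding psi'_def quartic_trace_eq_sum by (simp only:)
  qed
  finally show ?thesis using deriv by simp
qed

text \<open>The four exponents of each word add up to \<open>2 * (m - 1)\<close>, and the first
  factor counts the words. For \<open>m = 0\<close> there are none, so the truncation is
  harmless.\<close>

lemma norm_psi'_le:
  assumes W: "\<And>Q1 Q2 Q3. unitary Q1 \<Longrightarrow> unitary Q2 \<Longrightarrow> unitary Q3 \<Longrightarrow> spectral_norm (quartic n H Q1 Q2 Q3) \<le> W"
  shows "norm (psi' (2 * m) t) \<le> real (\<Sum>q\<le>2 * m. (2 * m - q) * q) * (4 * W * (real CARD('d) * moment (2 * (m - 1))))"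
proof -
  have summand: "norm (LINT \<omega>|P. quartic_trace n H (matpow (Z t \<omega>) (2 * m - q - 1 - r))
      (matpow (X (fst \<omega>)) r') (matpow (X (fst \<omega>)) (q - 1 - r')) (matpow (Z t \<omega>) r))
      \<le> 4 * W * (real CARD('d) * moment (2 * (m - 1)))" (is "norm (LINT \<omega>|P. ?Q \<omega>) \<le> _")
    if r: "r < 2 * m - q" "r' < q" for q r r'
  proof -
    define N where "N = 2 * (m - 1)"
    have int: "integrable P ?Q"
      unfolding quartic_trace_eq_sum
      by (intro Bochner_Integration.integrable_sum pair.integrable_trace_rmat rmat_intros)
    have intX: "integrable P (\<lambda>\<omega>. trace (matpow (X (fst \<omega>)) N))"
      and intZ: "integrable P (\<lambda>\<omega>. trace (matpow (Z t \<omega>) N))"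
      by (intro pair.integrable_trace_rmat rmat_intros)+
    \<comment> \<open>A cyclic shift turns the order Z, X, X, Z into X, X, Z, Z, the form of
      \<open>quartic_trace_matpow_le\<close>.\<close>
    have bound: "norm (?Q \<omega>) \<le> 2 * W * (Re (trace (matpow (X (fst \<omega>)) N)) + Re (trace (matpow (Z t \<omega>) N)))" for \<omega>
      unfolding N_def quartic_trace_cyclic[of n H "matpow (Z t \<omega>) (2 * m - q - 1 - r)"]
      using r by (intro quartic_trace_matpow_le[OF W hermitian_X hermitian_Z]) auto
    have "norm (LINT \<omega>|P. ?Q \<omega>) \<le> (LINT \<omega>|P. norm (?Q \<omega>))" by (rule integral_norm_bound)
    also have "\<dots> \<le> (LINT \<omega>|P. 2 * W * (Re (trace (matpow (X (fst \<omega>)) N)) + Re (trace (matpow (Z t \<omega>) N))))"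
      using int intX intZ bound
      by (intro integral_mono integrable_norm integrable_mult_right Bochner_Integration.integrable_add integrable_Re)
    also have "\<dots> = 2 * W * (Re (LINT \<omega>|P. trace (matpow (X (fst \<omega>)) N)) + Re (LINT \<omega>|P. trace (matpow (Z t \<omega>) N)))"
      using intX intZ by (simp add: integral_Re integrable_Re Bochner_Integration.integral_add)
    also have "\<dots> = 4 * W * (real CARD('d) * moment N)"
      by (simp add: expectation_trace_Z expectation_trace_fst expectation_trace_eq_moment)
    finally show ?thesis by (simp add: N_def)
  qed
  have "norm (psi' (2 * m) t) \<le> (\<Sum>q\<le>2 * m. \<Sum>r<2 * m - q. \<Sum>r'<q. 4 * W * (real CARD('d) * moment (2 * (m - 1))))"
    unfolding psi'_def by (intro sum_norm_le summand) auto
  also have "\<dots> = real (\<Sum>q\<le>2 * m. (2 * m - q) * q) * (4 * W * (real CARD('d) * moment (2 * (m - 1))))"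
    by (simp add: sum_distrib_right mult.assoc)
  finally show ?thesis .
qed

end

section \<open>The moment recursion\<close>

text \<open>Here \<open>(2 * k + 1) * k\<^sup>2\<close> bounds the number of words in
  \<open>psi'\<close> and the 4 comes from the slots. The factors \<open>4 * k\<close> and
  \<open>k * (2 * k + 1)\<close> are compared with the second and third power of
  \<open>k + 1\<close>.\<close>

lemma four_mult_odd_mult_square_le: "4 * ((2 * k + 1) * k\<^sup>2) \<le> (k + 1) ^ 5" for k :: nat
proof -
  have "4 * k \<le> (k + 1)\<^sup>2" by (cases k) (simp_all add: power2_eq_square algebra_simps)
  moreover have "k * (2 * k + 1) \<le> (k + 1) * (k + 1)\<^sup>2"
    by (intro mult_mono) (simp_all add: power2_eq_square algebra_simps)
  ultimately have "4 * k * (k * (2 * k + 1)) \<le> (k + 1)\<^sup>2 * ((k + 1) * (k + 1)\<^sup>2)"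
    by (rule mult_le_mono)
  also have "\<dots> = (k + 1) ^ 5" by (simp only: numeral_eq_Suc pred_numeral_simps power_Suc power_0 mult_1_right
        mult.assoc, simp add: numeral_eq_Suc)
  finally show ?thesis by (simp only: power2_eq_square mult_ac)
qed

lemma sum_even_indices:
  fixes f :: "nat \<Rightarrow> real"
  assumes "\<And>q. odd q \<Longrightarrow> f q = 0"
  shows "(\<Sum>q\<le>2 * m. f q) = (\<Sum>j\<le>m. f (2 * j))"
proof (induction m)
  case (Suc m)
  have "(\<Sum>q\<le>2 * Suc m. f q) = (\<Sum>q\<le>2 * m. f q) + f (Suc (2 * m)) + f (2 * Suc m)" by simp
  with Suc show ?case using assms[of "Suc (2 * m)"] by simp
qed simp

text \<open>The majorant \<open>2\<close> of the truncated generating function solves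
  \<open>2 \<ge> 1 + s\<^sup>2 z 2\<^sup>2 + L z\<^sup>2 2\<close> at \<open>z = u\<^sup>-\<^sup>2\<close>; since the constant term is \<open>1\<close>, every other
  term is at most \<open>1\<close>.\<close>

lemma catalan_type_recursion_bound:
  fixes a :: "nat \<Rightarrow> real"
  assumes a0: "a 0 = 1" and nonneg: "\<And>k. 0 \<le> a k"
    and rec: "\<And>k. k < p \<Longrightarrow> a (Suc k) \<le> s\<^sup>2 * (\<Sum>j\<le>k. a j * a (k - j)) + (if k = 0 then 0 else L * a (k - 1))"
    and s: "0 \<le> s" and l: "0 \<le> l" and L: "2 * L = l ^ 4"
  shows "a p \<le> (2 * s + l) ^ (2 * p)"
proof (cases "2 * s + l = 0")
  \<comment> \<open>There is no scale to normalise by: \<open>s\<close> and \<open>L\<close> vanish,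
    and the recursion itself forces \<open>a p = 0\<close> for \<open>p > 0\<close>.\<close>
  case True
  then have "s = 0" "l = 0" using s l by auto
  then have "s = 0" "L = 0" using L by simp_all
  then show ?thesis using a0 rec[of "p - 1"] True by (cases p) (auto split: if_splits)
next
  case False
  define u where "u = 2 * s + l"
  have u: "0 < u" using False s l by (simp add: u_def)
  define z where "z = 1 / u\<^sup>2"
  have z: "0 < z" using u by (simp add: z_def)
  have L0: "0 \<le> L" using L zero_le_power[OF l, of 4] by linarith
  define f where "f k = a k * z ^ k" for k
  have f: "0 \<le> f k" for k using nonneg z by (simp add: f_def)
  \<comment> \<open>By \<open>u = 2 * s + l\<close> the right-hand side is
    \<open>u\<^sup>2 * (u\<^sup>2 - 4 * s\<^sup>2)\<close>, so this is the majorant inequality with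
    denominators cleared. It rests on \<open>l \<le> u\<close> and
    \<open>l \<le> 4 * s + l\<close>.\<close>
  have "l ^ 4 \<le> u\<^sup>2 * (l * (4 * s + l))"
  proof -
    have "l\<^sup>2 * (l * l) \<le> u\<^sup>2 * (l * (4 * s + l))"
      using s l by (intro mult_mono power_mono) (auto simp: u_def)
    then show ?thesis by (simp add: power2_eq_square power4_eq_xxxx mult_ac)
  qed
  also have "\<dots> = u ^ 4 - 4 * s\<^sup>2 * u\<^sup>2"
    by (simp add: u_def power2_eq_square power4_eq_xxxx algebra_simps)
  finally have key: "4 * s\<^sup>2 * u\<^sup>2 + 2 * L \<le> u ^ 4" using L by simp
  have "s\<^sup>2 * z * 4 + L * z\<^sup>2 * 2 = (4 * s\<^sup>2 * u\<^sup>2 + 2 * L) / u ^ 4"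
    using u by (simp add: z_def power2_eq_square power4_eq_xxxx field_simps)
  also have "\<dots> \<le> 1" using key u by simp
  finally have key': "s\<^sup>2 * z * 4 + L * z\<^sup>2 * 2 \<le> 1" .
  \<comment> \<open>Bootstrap: if the partial sum up to \<open>m\<close> is at most 2, the next one
    is at most 1 plus the left-hand side of \<open>key'\<close>. The range \<open>m \<le> p\<close>
    reflects that the recursion, with \<open>L\<close> fixed, is assumed only below
    \<open>p\<close>.\<close>
  have A: "(\<Sum>k\<le>m. f k) \<le> 2" if "m \<le> p" for m
    using that
  proof (induction m)
    case 0
    then show ?case by (simp add: f_def a0)
  next
    case (Suc m)
    define A where "A = (\<Sum>k\<le>m. f k)"
    have A2: "A \<le> 2" and A0: "0 \<le> A" using Suc f by (auto simp: A_def sum_nonneg)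
    have "f (Suc k) \<le> s\<^sup>2 * z * (\<Sum>j\<le>k. f j * f (k - j)) + L * z\<^sup>2 * (if k = 0 then 0 else f (k - 1))"
      if "k \<le> m" for k
    proof -
      have "f (Suc k) \<le> (s\<^sup>2 * (\<Sum>j\<le>k. a j * a (k - j)) + (if k = 0 then 0 else L * a (k - 1))) * z ^ Suc k"
        unfolding f_def using that Suc.prems z by (intro mult_right_mono rec) auto
      also have "\<dots> = s\<^sup>2 * z * ((\<Sum>j\<le>k. a j * a (k - j)) * z ^ k) +
          (if k = 0 then 0 else L * a (k - 1)) * z ^ Suc k"
        by (simp add: algebra_simps)
      also have "(\<Sum>j\<le>k. a j * a (k - j)) * z ^ k = (\<Sum>j\<le>k. f j * f (k - j))"
      proof -
        have "a j * a (k - j) * z ^ k = f j * f (k - j)" if "j \<le> k" for j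
        proof -
          have "z ^ k = z ^ j * z ^ (k - j)" using that by (simp flip: power_add)
          then show ?thesis by (simp add: f_def)
        qed
        then show ?thesis by (simp add: sum_distrib_right)
      qed
      also have "(if k = 0 then 0 else L * a (k - 1)) * z ^ Suc k = L * z\<^sup>2 * (if k = 0 then 0 else f (k - 1))"
        by (cases k) (simp_all add: f_def power2_eq_square)
      finally show ?thesis .
    qed
    then have "(\<Sum>k\<le>m. f (Suc k)) \<le>
        (\<Sum>k\<le>m. s\<^sup>2 * z * (\<Sum>j\<le>k. f j * f (k - j)) + L * z\<^sup>2 * (if k = 0 then 0 else f (k - 1)))"
      by (intro sum_mono) simp
    also have "\<dots> = s\<^sup>2 * z * (\<Sum>k\<le>m. \<Sum>j\<le>k. f j * f (k - j)) + L * z\<^sup>2 * (\<Sum>k\<le>m. if k = 0 then 0 else f (k - 1))"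
      by (simp add: sum.distrib sum_distrib_left)
    also have "(\<Sum>k\<le>m. \<Sum>j\<le>k. f j * f (k - j)) \<le> A * A"
    proof -
      have "(\<Sum>k\<le>m. \<Sum>j\<le>k. f j * f (k - j)) = (\<Sum>(i, j)\<in>{(i, j). i + j \<le> m}. f i * f j)"
        by (rule sum.triangle_reindex_eq[symmetric])
      also have "\<dots> \<le> (\<Sum>(i, j)\<in>{..m} \<times> {..m}. f i * f j)"
        using f by (intro sum_mono2) auto
      also have "\<dots> = A * A"
        by (simp add: A_def sum_product sum.cartesian_product)
      finally show ?thesis .
    qed
    also have "A * A \<le> 4" using mult_mono[OF A2 A2] A0 by simp
    also have "(\<Sum>k\<le>m. if k = 0 then 0 else f (k - 1)) \<le> A"
    proof (cases m)
      case (Suc m')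
      have "(\<Sum>k\<le>m. if k = 0 then 0 else f (k - 1)) = (\<Sum>k\<le>m'. f k)"
        unfolding Suc by (subst sum.atMost_Suc_shift) simp
      also have "\<dots> \<le> A" unfolding A_def Suc using f by (intro sum_mono2) auto
      finally show ?thesis .
    qed (simp add: A0)
    also note A2
    finally have "(\<Sum>k\<le>m. f (Suc k)) \<le> s\<^sup>2 * z * 4 + L * z\<^sup>2 * 2" using s z L0 by (simp add: mult_left_mono)
    with key' have "(\<Sum>k\<le>m. f (Suc k)) \<le> 1" by linarith
    then show ?case by (subst sum.atMost_Suc_shift) (simp add: f_def a0)
  qed
  have "f p \<le> 1"
  proof (cases p)
    case (Suc k)
    have "f 0 + f p \<le> (\<Sum>i\<in>{0, p}. f i)" using Suc by simp
    also have "\<dots> \<le> (\<Sum>i\<le>p. f i)" using f by (intro sum_mono2) auto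
    finally show ?thesis using A[of p] by (simp add: f_def a0)
  qed (simp add: f_def a0)
  then have "a p / u ^ (2 * p) \<le> 1"
    by (simp add: f_def z_def power_divide power_mult)
  then show ?thesis using u by (simp add: divide_le_eq u_def)
qed

section \<open>Isotropy closes the recursion\<close>

context gaussian_sum
begin

lemma expectation_matpow_isotropic:
  assumes "strongly_isotropic M (gaussian_matrix n H \<gamma>)"
  shows "(LINT \<omega>|M. matpow (X \<omega>) q) = moment q *\<^sub>R mat 1"
proof -
  have "(LINT \<omega>|M. normalized_trace (matpow (X \<omega>) q)) = of_real (moment q)"
    unfolding normalized_trace_def by (simp add: expectation_trace_eq_moment)
  moreover have "mat (of_real c) = c *\<^sub>R (mat 1 :: complex^'d^'d)" for c
    by (simp add: vec_eq_iff mat_def) (simp add: scaleR_conv_of_real)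
  ultimately show ?thesis
    using assms by (simp add: strongly_isotropic_def X_def)
qed

text \<open>The quarter turn makes \<open>Z\<close> the second copy. The trace is bilinear in the
  entries of two independent factors, so each is averaged separately; isotropy makes the averages
  multiples of \<open>H k\<close>, and only \<open>H k ** H k\<close> is left.\<close>

lemma psi_pi_half:
  assumes iso: "strongly_isotropic M (gaussian_matrix n H \<gamma>)"
  shows "psi m (pi / 2) = of_real (\<Sum>q\<le>m. moment q * moment (m - q)) * trace (\<Sum>k=1..n. matpow (H k) 2)"
proof -
  have Z: "Z (pi / 2) \<omega> = X (snd \<omega>)" for \<omega> by (simp add: Z_def)
  have "(LINT \<omega>|P. trace (H k ** matpow (X (fst \<omega>)) q ** H k ** matpow (X (snd \<omega>)) s)) =
      of_real (moment q * moment s) * trace (matpow (H k) 2)" for k q s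
  proof -
    have int: "integrable M (\<lambda>\<omega>. (H k ** matpow (X \<omega>) r) $ i $ j)" for r i j
      by (intro base.integrable_nth_rmat[where t = 0] base.rmat_mult base.rmat_const base.rmat_matpow rmat_X_base)
    have mean: "(LINT \<omega>|M. (H k ** matpow (X \<omega>) r) $ i $ j) = moment r *\<^sub>R H k $ i $ j" for r i j
    proof -
      have intX: "integrable M (\<lambda>\<omega>. matpow (X \<omega>) r)"
        by (intro integrable_matrix base.integrable_nth_rmat[where t = 0] base.rmat_matpow rmat_X_base)
      have "(LINT \<omega>|M. (H k ** matpow (X \<omega>) r) $ i $ j) = (LINT \<omega>|M. H k ** matpow (X \<omega>) r) $ i $ j"
        by (rule integral_matrix_nth[OF integrable_matrix[OF int], symmetric])
      also have "\<dots> = (H k ** (moment r *\<^sub>R mat 1)) $ i $ j"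
        unfolding integral_matrix_mult_left[OF intX] expectation_matpow_isotropic[OF iso] ..
      finally show ?thesis by (simp add: matrix_mult_scaleR_right)
    qed
    have "trace (H k ** matpow (X (fst \<omega>)) q ** H k ** matpow (X (snd \<omega>)) s) =
        (\<Sum>i\<in>UNIV. \<Sum>j\<in>UNIV. (H k ** matpow (X (fst \<omega>)) q) $ i $ j * (H k ** matpow (X (snd \<omega>)) s) $ j $ i)" for \<omega>
      unfolding trace_def matrix_mult_nth[of "H k ** matpow (X (fst \<omega>)) q" "H k ** matpow (X (snd \<omega>)) s", symmetric]
      by (simp add: matrix_mul_assoc)
    then have "(LINT \<omega>|P. trace (H k ** matpow (X (fst \<omega>)) q ** H k ** matpow (X (snd \<omega>)) s)) =
        (LINT \<omega>|P. (\<Sum>i\<in>UNIV. \<Sum>j\<in>UNIV. (H k ** matpow (X (fst \<omega>)) q) $ i $ j * (H k ** matpow (X (snd \<omega>)) s) $ j $ i))"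
      by simp
    also have "\<dots> = (\<Sum>i\<in>UNIV. \<Sum>j\<in>UNIV. LINT \<omega>|P. (H k ** matpow (X (fst \<omega>)) q) $ i $ j * (H k ** matpow (X (snd \<omega>)) s) $ j $ i)"
      by (subst Bochner_Integration.integral_sum,
          intro Bochner_Integration.integrable_sum MM.integrable_integral_product(1) int)
         (intro sum.cong refl Bochner_Integration.integral_sum MM.integrable_integral_product(1) int)
    also have "\<dots> = (\<Sum>i\<in>UNIV. \<Sum>j\<in>UNIV. (moment q *\<^sub>R H k $ i $ j) * (moment s *\<^sub>R H k $ j $ i))"
      by (intro sum.cong refl) (simp only: MM.integrable_integral_product(2)[OF int int] mean)
    also have "\<dots> = of_real (moment q * moment s) * trace (H k ** H k)"
      by (simp add: trace_def matrix_mult_nth sum_distrib_left scaleR_conv_of_real mult_ac)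
    finally show ?thesis by (simp add: numeral_2_eq_2)
  qed
  then show ?thesis
    by (simp add: psi_def Z trace_sum sum_product)
qed

text \<open>The value of \<open>psi (2 * m)\<close> at 0 exceeds the one at \<open>pi / 2\<close> by
  at most the integral of \<open>sin t\<close> times a bound on \<open>psi'\<close>. In the product
  sum at the quarter turn the odd moments drop out.\<close>

lemma moment_recursion:
  assumes iso: "strongly_isotropic M (gaussian_matrix n H \<gamma>)"
    and W: "\<And>Q1 Q2 Q3. unitary Q1 \<Longrightarrow> unitary Q2 \<Longrightarrow> unitary Q3 \<Longrightarrow> spectral_norm (quartic n H Q1 Q2 Q3) \<le> W"
  shows "moment (2 * Suc m) \<le> spectral_norm (\<Sum>k=1..n. matpow (H k) 2) * (\<Sum>j\<le>m. moment (2 * j) * moment (2 * (m - j)))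
    + 4 * real ((2 * m + 1) * m\<^sup>2) * W * moment (2 * (m - 1))"
proof -
  let ?d = "real CARD('d)" and ?V = "\<Sum>k=1..n. matpow (H k) 2"
  have W0: "0 \<le> W" by (rule quartic_bound_nonneg[OF W])
  define c where "c = real (\<Sum>q\<le>2 * m. (2 * m - q) * q) * (4 * W * (?d * moment (2 * (m - 1))))"
  \<comment> \<open>Subtracting \<open>c * cos t\<close> yields a nondecreasing function; this takes
    the place of integrating \<open>c * sin t\<close> over the quarter turn, which gives
    \<open>c\<close>.\<close>
  have deriv: "((\<lambda>t. Re (psi (2 * m) t) - c * cos t) has_real_derivative
      (- sin t * Re (psi' (2 * m) t) + c * sin t)) (at t)" for t
  proof -
    have "((\<lambda>t. Re (psi (2 * m) t)) has_real_derivative - sin t * Re (psi' (2 * m) t)) (at t)"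
      unfolding has_field_derivative_def
      by (rule has_derivative_eq_rhs[OF has_derivative_Re[OF psi_deriv[unfolded has_vector_derivative_def]]])
         (simp add: fun_eq_iff)
    from DERIV_diff[OF this DERIV_cmult[OF DERIV_cos, where c = c]] show ?thesis by simp
  qed
  have "Re (psi (2 * m) 0) - c * cos 0 \<le> Re (psi (2 * m) (pi / 2)) - c * cos (pi / 2)"
  proof (rule DERIV_nonneg_imp_nondecreasing[of 0 "pi / 2" "\<lambda>t. Re (psi (2 * m) t) - c * cos t"])
    fix t :: real assume t: "0 \<le> t" "t \<le> pi / 2"
    have "0 \<le> sin t" using t by (intro sin_ge_zero) auto
    moreover have "Re (psi' (2 * m) t) \<le> c"
      using norm_psi'_le[OF W, of m t] complex_Re_le_cmod[of "psi' (2 * m) t"] by (simp add: c_def)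
    ultimately have "0 \<le> sin t * (c - Re (psi' (2 * m) t))" by simp
    then show "\<exists>y. ((\<lambda>t. Re (psi (2 * m) t) - c * cos t) has_real_derivative y) (at t) \<and> 0 \<le> y"
      using deriv[of t] by (intro exI[of _ "- sin t * Re (psi' (2 * m) t) + c * sin t"]) (simp add: algebra_simps)
  qed simp
  then have "?d * moment (2 * Suc m) \<le> (\<Sum>q\<le>2 * m. moment q * moment (2 * m - q)) * Re (trace ?V) + c"
    unfolding psi_0 psi_pi_half[OF iso] by simp
  also have "(\<Sum>q\<le>2 * m. moment q * moment (2 * m - q)) = (\<Sum>j\<le>m. moment (2 * j) * moment (2 * (m - j)))"
    by (subst sum_even_indices) (simp_all add: moment_odd right_diff_distrib')
  also have "\<dots> * Re (trace ?V) \<le> (\<Sum>j\<le>m. moment (2 * j) * moment (2 * (m - j))) * (?d * spectral_norm ?V)"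
    using norm_trace_le[of ?V] complex_Re_le_cmod[of "trace ?V"]
    by (intro mult_left_mono sum_nonneg mult_nonneg_nonneg moment_even_nonneg) simp
  also have "c \<le> real ((2 * m + 1) * m\<^sup>2) * (4 * W * (?d * moment (2 * (m - 1))))"
  proof -
    have "(2 * m - q) * q \<le> m\<^sup>2" if "q \<le> 2 * m" for q
    proof -
      have "int ((2 * m - q) * q) = (int m)\<^sup>2 - (int m - int q)\<^sup>2"
        using that by (simp add: of_nat_diff power2_eq_square algebra_simps)
      also have "\<dots> \<le> int (m\<^sup>2)" by simp
      finally show ?thesis by (simp only: of_nat_le_iff)
    qed
    then have "(\<Sum>q\<le>2 * m. (2 * m - q) * q) \<le> (\<Sum>q\<le>2 * m. m\<^sup>2)" by (intro sum_mono) simp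
    also have "\<dots> = (2 * m + 1) * m\<^sup>2" by (simp add: algebra_simps)
    finally show ?thesis
      unfolding c_def using W0 moment_even_nonneg[of "m - 1"]
      by (intro mult_right_mono) (simp_all only: of_nat_le_iff mult_nonneg_nonneg of_nat_0_le_iff zero_le_numeral)
  qed
  finally have "?d * moment (2 * Suc m) \<le> ?d * (spectral_norm ?V * (\<Sum>j\<le>m. moment (2 * j) * moment (2 * (m - j)))
      + 4 * real ((2 * m + 1) * m\<^sup>2) * W * moment (2 * (m - 1)))"
    by (simp add: algebra_simps)
  then show ?thesis by (simp only: mult_le_cancel_left_pos of_nat_0_less_iff zero_less_card_finite)
qed

end

theorem theorem3p11:
  fixes M :: "'a measure"
    and n p :: nat
    and H :: "nat \<Rightarrow> complex^'d^'d"
    and \<gamma> :: "nat \<Rightarrow> 'a \<Rightarrow> real"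
  assumes "prob_space M"
    and "\<And>i. i \<in> {1..n} \<Longrightarrow> hermitian (H i)"
    and "prob_space.indep_vars M (\<lambda>_. borel) \<gamma> {1..n}"
    and "\<And>i. i \<in> {1..n} \<Longrightarrow> distributed M lborel (\<gamma> i) std_normal_density"
    and "strongly_isotropic M (gaussian_matrix n H \<gamma>)"
    and "p \<ge> 1"
  shows "(LINT \<omega>|M. schatten_norm (2 * p) (gaussian_matrix n H \<gamma> \<omega>) ^ (2 * p)) powr (1 / (2 * real p))
    \<le> (2 * sigma_par n H + 2 powr (1/4) * real p powr (5/4) * w_par n H)
        * real CARD('d) powr (1 / (2 * real p))"
proof -
  interpret gaussian_sum M n H \<gamma>
    using assms(1-4) by (intro gaussian_sum.intro gaussian_sum_axioms.intro)
  note iso = assms(5)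
  let ?d = "real CARD('d)" and ?V = "\<Sum>i=1..n. matpow (H i) 2"
  define s where "s = sigma_par n H"
  define w where "w = w_par n H"
  \<comment> \<open>Chosen so that \<open>l ^ 4\<close> is twice the coefficient
    \<open>p^5 w^4\<close>; the factor 2 is the value of the majorant in
    \<open>catalan_type_recursion_bound\<close>.\<close>
  define l where "l = 2 powr (1/4) * real p powr (5/4) * w"
  have s0: "0 \<le> s" by (simp add: s_def sigma_par_def)
  have s2: "s\<^sup>2 = spectral_norm ?V"
    using spectral_norm_nonneg[of ?V] by (simp add: s_def sigma_par_def powr_half_sqrt)
  have w0: "0 \<le> w" using w_par_attained[of n H] by (auto simp: w_def)
  have W: "spectral_norm (quartic n H Q1 Q2 Q3) \<le> w ^ 4"
    if "unitary Q1" "unitary Q2" "unitary Q3" for Q1 Q2 Q3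
  proof -
    have "(spectral_norm (quartic n H Q1 Q2 Q3) powr (1/4)) ^ 4 \<le> w ^ 4"
      unfolding w_def by (intro power_mono w_par_upper that) simp
    also have "(spectral_norm (quartic n H Q1 Q2 Q3) powr (1/4)) ^ 4 = spectral_norm (quartic n H Q1 Q2 Q3)"
      using spectral_norm_nonneg[of "quartic n H Q1 Q2 Q3"]
      by (cases "spectral_norm (quartic n H Q1 Q2 Q3) = 0") (simp_all add: powr_powr flip: powr_realpow)
    finally show ?thesis .
  qed
  have l0: "0 \<le> l" using w0 by (simp add: l_def)
  have l4: "2 * (real p ^ 5 * w ^ 4) = l ^ 4"
  proof -
    have "(2 powr (1/4)) ^ 4 = (2::real)" by (simp add: powr_powr flip: powr_realpow)
    moreover have "(real p powr (5/4)) ^ 4 = real p ^ 5"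
      using assms(6) by (simp add: powr_power)
    ultimately show ?thesis by (simp add: l_def power_mult_distrib)
  qed
  have "moment (2 * p) \<le> (2 * s + l) ^ (2 * p)"
  proof (rule catalan_type_recursion_bound[OF _ _ _ s0 l0 l4])
    fix k assume k: "k < p"
    \<comment> \<open>The majorant takes a single coefficient for all \<open>k < p\<close>, hence
      the power of \<open>p\<close> instead of \<open>k + 1\<close>. At \<open>k = 0\<close> the
      word count vanishes, which matches the 0 in the recursion.\<close>
    have poly: "4 * ((2 * k + 1) * k\<^sup>2) \<le> p ^ 5"
      using k by (intro order_trans[OF four_mult_odd_mult_square_le] power_mono) auto
    have "4 * real ((2 * k + 1) * k\<^sup>2) * w ^ 4 * moment (2 * (k - 1)) \<le>
        (if k = 0 then 0 else real p ^ 5 * w ^ 4 * moment (2 * (k - 1)))"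
    proof (cases "k = 0")
      case False
      have "real (4 * ((2 * k + 1) * k\<^sup>2)) \<le> real (p ^ 5)" using poly by (simp only: of_nat_le_iff)
      then have "4 * real ((2 * k + 1) * k\<^sup>2) \<le> real p ^ 5" by simp
      then show ?thesis
        using False w0 moment_even_nonneg[of "k - 1"] by (simp add: mult_right_mono)
    qed simp
    with moment_recursion[OF iso W, of k]
    show "moment (2 * Suc k) \<le> s\<^sup>2 * (\<Sum>j\<le>k. moment (2 * j) * moment (2 * (k - j))) +
        (if k = 0 then 0 else real p ^ 5 * w ^ 4 * moment (2 * (k - 1)))"
      unfolding s2 by linarith
  qed (simp_all add: moment_0 moment_even_nonneg)
  moreover have "(LINT \<omega>|M. schatten_norm (2 * p) (gaussian_matrix n H \<gamma> \<omega>) ^ (2 * p)) = ?d * moment (2 * p)"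
  proof -
    have "(LINT \<omega>|M. schatten_norm (2 * p) (gaussian_matrix n H \<gamma> \<omega>) ^ (2 * p)) =
        (LINT \<omega>|M. Re (trace (matpow (X \<omega>) (2 * p))))"
      using schatten_norm_even_power[OF hermitian_X assms(6)] by (simp add: X_def)
    also have "\<dots> = Re (LINT \<omega>|M. trace (matpow (X \<omega>) (2 * p)))"
      by (intro integral_Re base.integrable_trace_rmat base.rmat_matpow rmat_X_base)
    finally show ?thesis by (simp add: expectation_trace_eq_moment)
  qed
  ultimately have "(LINT \<omega>|M. schatten_norm (2 * p) (gaussian_matrix n H \<gamma> \<omega>) ^ (2 * p)) powr (1 / (2 * real p))
      \<le> (?d * (2 * s + l) ^ (2 * p)) powr (1 / (2 * real p))"
    using moment_even_nonneg[of p] by (intro powr_mono2) (simp_all add: mult_left_mono)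
  also have "\<dots> = ?d powr (1 / (2 * real p)) * ((2 * s + l) ^ (2 * p)) powr (1 / (2 * real p))"
    by (rule powr_mult)
  also have "((2 * s + l) ^ (2 * p)) powr (1 / (2 * real p)) = 2 * s + l"
  proof (cases "2 * s + l = 0")
    case True
    then show ?thesis using assms(6) by simp
  next
    case False
    then have "0 < 2 * s + l" using s0 l0 by simp
    then have "(2 * s + l) ^ (2 * p) = (2 * s + l) powr (2 * real p)"
      using powr_realpow[of "2 * s + l" "2 * p"] by simp
    then show ?thesis using assms(6) s0 l0 by (simp add: powr_powr)
  qed
  finally show ?thesis by (simp add: s_def l_def w_def mult.commute)
qed

end
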